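(* Let $k\ge 2$, and let $M$ be either $M_{k,1}$ or ${\it Inv}_{k,1}$. For any non-zero elements $\varphi,\psi$ of $M$, the $D$-relation of $M$ is characterized by $$\varphi\equiv_D\psi \quad\text{iff}\quad |{\rm imC}(\varphi)|\equiv|{\rm imC}(\psi)| \pmod{k-1}.$$ Hence $M_{k,1}$ and ${\it Inv}_{k,1}$ have $k-1$ non-zero $D$-classes. In particular, $M_{2,1}$ and ${\it Inv}_{2,1}$ are $0$-$D$-simple (i.e., all their non-zero elements form a single $D$-class; this is also called $0$-bisimple).
   Context: Let $k\ge 2$ and $A=\{a_1,\dots,a_k\}$ an alphabet; $A^*$ is the set of all finite words over $A$, with empty word $\varepsilon$. A right ideal of $A^*$ is a set $R\subseteq A^*$ with $RA^*\subseteq R$ (the empty set is allowed). A prefix code is a set $C\subseteq A^*$ in which no element is a prefix of another element. Every right ideal $R$ equals $CA^*$ for a unique prefix code $C$; $R$ is finitely generated iff $C$ is finite. A right ideal homomorphism is a total function $\varphi: R_1\to A^*$, where $R_1={\rm Dom}(\varphi)$ is a right ideal, with $\varphi(xw)=\varphi(x)w$ for all $x\in R_1$, $w\in A^*$; an injective one is called a right ideal isomorphism (onto its image). For right ideals $R'\subseteq R$, $R'$ is essential in $R$ iff $R'$ intersects every non-empty right ideal contained in $R$. $\Phi$ is an essential restriction of $\varphi$ (and $\varphi$ an essential extension of $\Phi$) iff ${\rm Dom}(\Phi)$ is contained and essential in ${\rm Dom}(\varphi)$ and $\varphi=\Phi$ on ${\rm Dom}(\Phi)$. Every right ideal homomorphism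 $\varphi$ with finitely generated domain has a unique maximal essential extension $\max(\varphi)$. $M_{k,1}$ is the monoid of all maximal essential extensions of right ideal homomorphisms between finitely generated right ideals of $A^*$, with multiplication $\varphi\cdot\psi=\max(\varphi\circ\psi)$; its zero element is the empty map. ${\it Inv}_{k,1}$ is the submonoid of maximal essential extensions of isomorphisms between finitely generated (not necessarily essential) right ideals. Every element $\varphi\in M_{k,1}$ has an essential restriction given by a table, i.e., a surjective function $P\to Q$, where $P$ (the prefix code generating the domain of the restriction) and $Q$ (the image of $P$) are both finite prefix codes; ${\rm imC}(\varphi)$ denotes such a $Q$, and the residue class of $|{\rm imC}(\varphi)|$ modulo $k-1$ does not depend on the choice of the table with these properties. For elements $x,y$ of a monoid $M$: $x\equiv_R y$ iff $xM=yM$; $x\equiv_L y$ iff $Mx=My$; $x\equiv_D y$ iff there exists $s\in M$ with $x\equiv_R s\equiv_L y$. *)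

theory Defs
  imports "HOL-Algebra.Coset" "HOL-Library.Cardinality" "HOL-Library.Sublist" "HOL-Number_Theory.Cong"
begin

text \<open>The alphabet is the type \<open>'a\<close>, so words are lists over \<open>'a\<close>, and \<open>k\<close> is
  \<open>CARD('a)\<close>. A partial function on words is a map \<open>'a list \<rightharpoonup> 'a list\<close>; the zero of the
  monoids below is \<open>Map.empty\<close>.\<close>

subsection \<open>Right ideals and prefix codes\<close>

definition right_ideal :: "'a list set \<Rightarrow> bool" where
  "right_ideal R \<longleftrightarrow> (\<forall>x\<in>R. \<forall>w. x @ w \<in> R)"

definition prefix_code :: "'a list set \<Rightarrow> bool" where
  "prefix_code C \<longleftrightarrow> (\<forall>x\<in>C. \<forall>y\<in>C. prefix x y \<longrightarrow> x = y)"

definition generated :: "'a list set \<Rightarrow> 'a list set" where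
  "generated C = {c @ w | c w. c \<in> C}"

definition fin_gen :: "'a list set \<Rightarrow> bool" where
  "fin_gen R \<longleftrightarrow> (\<exists>C. finite C \<and> prefix_code C \<and> R = generated C)"

definition essential_in :: "'a list set \<Rightarrow> 'a list set \<Rightarrow> bool" where
  "essential_in R' R \<longleftrightarrow>
     R' \<subseteq> R \<and> (\<forall>J. right_ideal J \<and> J \<noteq> {} \<and> J \<subseteq> R \<longrightarrow> J \<inter> R' \<noteq> {})"

subsection \<open>Right ideal homomorphisms and maximal essential extensions\<close>

definition right_ideal_hom :: "('a list \<rightharpoonup> 'a list) \<Rightarrow> bool" where
  "right_ideal_hom \<phi> \<longleftrightarrow>
     right_ideal (dom \<phi>) \<and> (\<forall>x y w. \<phi> x = Some y \<longrightarrow> \<phi> (x @ w) = Some (y @ w))"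

definition ess_restriction :: "('a list \<rightharpoonup> 'a list) \<Rightarrow> ('a list \<rightharpoonup> 'a list) \<Rightarrow> bool" where
  "ess_restriction \<Phi> \<phi> \<longleftrightarrow>
     right_ideal_hom \<Phi> \<and> right_ideal_hom \<phi> \<and> essential_in (dom \<Phi>) (dom \<phi>) \<and> \<Phi> \<subseteq>\<^sub>m \<phi>"

definition max_ext :: "('a list \<rightharpoonup> 'a list) \<Rightarrow> ('a list \<rightharpoonup> 'a list)" where
  "max_ext \<phi> = (THE \<psi>. ess_restriction \<phi> \<psi> \<and>
     (\<forall>\<chi>. ess_restriction \<phi> \<chi> \<and> \<psi> \<subseteq>\<^sub>m \<chi> \<longrightarrow> \<chi> = \<psi>))"

subsection \<open>The monoids\<close>

definition fg_hom :: "('a list \<rightharpoonup> 'a list) \<Rightarrow> bool" where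
  "fg_hom \<phi> \<longleftrightarrow> right_ideal_hom \<phi> \<and> fin_gen (dom \<phi>) \<and> fin_gen (ran \<phi>)"

definition M_k1 :: "('a list \<rightharpoonup> 'a list) monoid" where
  "M_k1 = \<lparr> carrier = {max_ext \<phi> | \<phi>. fg_hom \<phi>},
            monoid.mult = (\<lambda>\<phi> \<psi>. max_ext (\<phi> \<circ>\<^sub>m \<psi>)),
            monoid.one = Some \<rparr>"

definition Inv_k1 :: "('a list \<rightharpoonup> 'a list) monoid" where
  "Inv_k1 = M_k1 \<lparr> carrier := {max_ext \<phi> | \<phi>. fg_hom \<phi> \<and> inj_on \<phi> (dom \<phi>)} \<rparr>"

subsection \<open>Image codes\<close>

definition is_imC :: "('a list \<rightharpoonup> 'a list) \<Rightarrow> 'a list set \<Rightarrow> bool" where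
  "is_imC \<phi> Q \<longleftrightarrow> (\<exists>\<Phi> P. ess_restriction \<Phi> \<phi> \<and>
     finite P \<and> prefix_code P \<and> dom \<Phi> = generated P \<and>
     Q = {q. \<exists>p\<in>P. \<Phi> p = Some q} \<and> finite Q \<and> prefix_code Q)"

text \<open>The image code is not unique, only its cardinality modulo \<open>k - 1\<close> is; \<open>imC\<close> is an
  unspecified choice.\<close>

definition imC :: "('a list \<rightharpoonup> 'a list) \<Rightarrow> 'a list set" where
  "imC \<phi> = (SOME Q. is_imC \<phi> Q)"

subsection \<open>Green's relations\<close>

definition green_R :: "('m, 'b) monoid_scheme \<Rightarrow> 'm rel" where
  "green_R M = {(x, y). x \<in> carrier M \<and> y \<in> carrier M \<and>
     x <#\<^bsub>M\<^esub> carrier M = y <#\<^bsub>M\<^esub> carrier M}"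

definition green_L :: "('m, 'b) monoid_scheme \<Rightarrow> 'm rel" where
  "green_L M = {(x, y). x \<in> carrier M \<and> y \<in> carrier M \<and>
     carrier M #>\<^bsub>M\<^esub> x = carrier M #>\<^bsub>M\<^esub> y}"

definition green_D :: "('m, 'b) monoid_scheme \<Rightarrow> 'm rel" where
  "green_D M = green_R M O green_L M"

definition zero_D_simple :: "('m, 'b) monoid_scheme \<Rightarrow> 'm \<Rightarrow> bool" where
  "zero_D_simple M z \<longleftrightarrow> carrier M - {z} \<in> carrier M // green_D M"

end

theory Submission imports Defs begin

text \<open>The invariant of the D-class of a non-zero \<open>\<phi>\<close> is the size, modulo k - 1, of a finite prefix code that
  generates the image of \<open>\<phi>\<close> up to essential equality. Here two right ideals count as essentially
  equal when every word of one has a continuation in the other. The residue is well defined because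
  a codeword q has k^(n - length q) continuations of length n, a number congruent to 1. So a finite
  prefix code has the same size modulo k - 1 as the set of words of length n in its ideal, for any
  large n, and that set is the same for essentially equal ideals (\<open>ess_equal_card_cong\<close>).

  The residue is an invariant: R-equivalent elements have essentially equal images, and if
  \<open>\<psi> = \<alpha> \<phi>\<close>, \<open>\<phi> = \<beta> \<psi>\<close>, then \<open>\<alpha>\<close> and \<open>\<beta>\<close> are mutually inverse between the images. Hence \<open>\<alpha>\<close>
  carries the words of a large length n in the image of \<open>\<phi>\<close> bijectively to a prefix code that
  generates the image of \<open>\<psi>\<close> up to essential equality (\<open>card_cong_of_mutual_inverse\<close>).

  The residue is complete: replacing a codeword by its k one-letter continuations adds k - 1
  codewords, so congruent non-empty image codes can be enlarged to codes of equal size. A bijection between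
  them acts as an element that is invertible where it matters and moves the image of \<open>\<psi>\<close> onto that
  of \<open>\<phi>\<close> without leaving the L-class of \<open>\<psi>\<close> (\<open>green_L_transport\<close>). Essential equality of the
  images gives R-equivalence, since preimages can be chosen codeword by codeword
  (\<open>factor_through\<close>). All these maps come out injective when \<open>\<phi>\<close> and \<open>\<psi>\<close> are, so one argument
  serves both monoids. Every residue occurs, as partial identities on the words that start with
  one of r given letters show (\<open>exists_imC_card\<close>); the zero element is a D-class of its own.

  To compute in the monoids, maximal essential extensions are described by an explicit formula,
  \<open>completion\<close>. It shows that homomorphisms that agree on an essential right ideal have the same
  completion (\<open>completion_cong_dense\<close>), from which the monoid laws follow.\<close>

section \<open>Right ideals up to essential equality\<close>

text \<open>For right ideals this says that \<open>J\<close> meets every non-empty right ideal inside \<open>I\<close>; without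
  the inclusion \<open>J \<subseteq> I\<close>, it is transitive and easily chained.\<close>

definition reaches :: "'a list set \<Rightarrow> 'a list set \<Rightarrow> bool" where
  "reaches I J \<longleftrightarrow> (\<forall>x\<in>I. \<exists>w. x @ w \<in> J)"

definition ess_equal :: "'a list set \<Rightarrow> 'a list set \<Rightarrow> bool" where
  "ess_equal I J \<longleftrightarrow> reaches I J \<and> reaches J I"

definition level :: "nat \<Rightarrow> 'a list set \<Rightarrow> 'a list set" where
  "level n I = {x \<in> I. length x = n}"

lemma reaches_trans: "reaches I J \<Longrightarrow> reaches J K \<Longrightarrow> reaches I K"
  unfolding reaches_def by (metis append.assoc)

lemma reaches_subset: "I \<subseteq> J \<Longrightarrow> reaches I J"
  unfolding reaches_def by (metis append_Nil2 subsetD)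

lemma ess_equal_sym: "ess_equal I J \<Longrightarrow> ess_equal J I"
  unfolding ess_equal_def by blast

lemma ess_equal_trans: "ess_equal I J \<Longrightarrow> ess_equal J K \<Longrightarrow> ess_equal I K"
  unfolding ess_equal_def by (blast intro: reaches_trans)

lemma right_idealD: "right_ideal R \<Longrightarrow> x \<in> R \<Longrightarrow> x @ w \<in> R"
  unfolding right_ideal_def by blast

lemma generatedI: "c \<in> C \<Longrightarrow> c @ w \<in> generated C"
  unfolding generated_def by blast

lemma generatedE:
  assumes "x \<in> generated C" obtains c w where "c \<in> C" "x = c @ w"
  using assms unfolding generated_def by blast

lemma right_ideal_generated: "right_ideal (generated C)"
  unfolding right_ideal_def generated_def by (auto, metis)

lemma essential_in_iff:
  assumes "right_ideal R"
  shows "essential_in R' R \<longleftrightarrow> R' \<subseteq> R \<and> reaches R R'"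
proof
  assume e: "essential_in R' R"
  have "\<exists>w. x @ w \<in> R'" if "x \<in> R" for x
  proof -
    have "generated {x} \<subseteq> R" "generated {x} \<noteq> {}"
      using assms that by (auto simp: generated_def right_ideal_def)
    then have "generated {x} \<inter> R' \<noteq> {}"
      using e right_ideal_generated unfolding essential_in_def by blast
    then show ?thesis by (auto simp: generated_def)
  qed
  then show "R' \<subseteq> R \<and> reaches R R'"
    using e unfolding essential_in_def reaches_def by blast
next
  assume "R' \<subseteq> R \<and> reaches R R'"
  then show "essential_in R' R"
    unfolding essential_in_def reaches_def right_ideal_def by blast
qed

lemma finite_bounded_words: "finite {x :: 'a::finite list. length x \<le> n}"
  using finite_lists_length_le[of "UNIV :: 'a set" n] by simp

text \<open>Over a finite alphabet, finite generation amounts to a bound on the length of the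
  minimal words of the ideal. This form makes it easy to check for domains of composites.\<close>

lemma fin_gen_iff:
  fixes R :: "'a::finite list set"
  shows "fin_gen R \<longleftrightarrow> right_ideal R \<and> (\<exists>n. \<forall>x\<in>R. take n x \<in> R)"
proof
  assume "fin_gen R"
  then obtain C where C: "finite C" "R = generated C" unfolding fin_gen_def by blast
  obtain n where n: "\<forall>c\<in>C. length c \<le> n"
    using C(1) by (metis finite_nat_set_iff_bounded_le finite_imageI imageI)
  have "take n x \<in> R" if "x \<in> R" for x
    using that n unfolding C(2) by (elim generatedE) (simp add: generatedI)
  then show "right_ideal R \<and> (\<exists>n. \<forall>x\<in>R. take n x \<in> R)"
    using C(2) right_ideal_generated by blast
next
  assume "right_ideal R \<and> (\<exists>n. \<forall>x\<in>R. take n x \<in> R)"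
  then obtain n where R: "right_ideal R" and n: "\<And>x. x \<in> R \<Longrightarrow> take n x \<in> R" by blast
  define C where "C = {x \<in> R. \<forall>y\<in>R. prefix y x \<longrightarrow> y = x}"
  have "C \<subseteq> {x. length x \<le> n}"
  proof
    fix x assume "x \<in> C"
    then have "take n x = x" using n take_is_prefix unfolding C_def by blast
    then show "x \<in> {x. length x \<le> n}" by (metis length_take mem_Collect_eq min.cobounded2 min.commute)
  qed
  then have "finite C" using finite_bounded_words finite_subset by blast
  moreover have "prefix_code C" unfolding C_def prefix_code_def by blast
  moreover have "R = generated C"
  proof
    show "generated C \<subseteq> R"
      using R unfolding C_def generated_def right_ideal_def by blast
    show "R \<subseteq> generated C"
    proof
      fix x assume x: "x \<in> R"
      define m where "m = (LEAST m. take m x \<in> R)"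
      have m: "take m x \<in> R" unfolding m_def by (rule LeastI[of _ "length x"]) (simp add: x)
      have "y = take m x" if y: "y \<in> R" "prefix y (take m x)" for y
      proof -
        have "y = take (length y) x"
          using y(2) by (metis append_eq_conv_conj prefix_def prefix_order.trans take_is_prefix)
        then have "m \<le> length y" unfolding m_def using y(1) by (metis Least_le)
        then have "length (take m x) \<le> length y" by simp
        moreover obtain u where "take m x = y @ u" using y(2) by (elim prefixE)
        ultimately show ?thesis by simp
      qed
      then have "take m x \<in> C" using m unfolding C_def by blast
      then show "x \<in> generated C" by (metis append_take_drop_id generatedI)
    qed
  qed
  ultimately show "fin_gen R" unfolding fin_gen_def by blast
qed

section \<open>Counting prefix codes modulo k - 1\<close>

text \<open>Below a word q there are k^(n - length q) words of length n, and k is 1 modulo k - 1.\<close>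

lemma card_level_generated:
  fixes Q :: "'a::finite list set"
  assumes "finite Q" "prefix_code Q" "\<forall>q\<in>Q. length q \<le> n" "CARD('a) \<ge> 1"
  shows "[card (level n (generated Q)) = card Q] (mod (CARD('a) - 1))"
proof -
  let ?B = "\<lambda>q. (@) q ` {w :: 'a list. length w = n - length q}"
  have eq: "level n (generated Q) = (\<Union>q\<in>Q. ?B q)"
    using assms(3) unfolding level_def generated_def by (auto intro!: imageI)
  have cB: "card (?B q) = CARD('a) ^ (n - length q)" for q
    using card_lists_length_eq[of "UNIV :: 'a set" "n - length q"]
    by (simp add: card_image inj_on_def)
  have fB: "finite (?B q)" for q
    using finite_lists_length_eq[of "UNIV :: 'a set" "n - length q"] by simp
  have "?B q \<inter> ?B r = {}" if "q \<in> Q" "r \<in> Q" "q \<noteq> r" for q r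
  proof -
    have "\<not> prefix q r" "\<not> prefix r q" using assms(2) that unfolding prefix_code_def by auto
    then show ?thesis by (auto simp: prefix_def append_eq_append_conv2)
  qed
  then have "card (level n (generated Q)) = (\<Sum>q\<in>Q. CARD('a) ^ (n - length q))"
    unfolding eq using assms(1) fB by (subst card_UN_disjoint) (auto simp: cB)
  moreover have "[CARD('a) = 1] (mod (CARD('a) - 1))"
    using assms(4) by (metis cong_def le_add_diff_inverse mod_add_self2)
  then have "[CARD('a) ^ m = 1] (mod (CARD('a) - 1))" for m
    using cong_pow by (metis power_one)
  then have "[(\<Sum>q\<in>Q. CARD('a) ^ (n - length q)) = (\<Sum>q\<in>Q. 1)] (mod (CARD('a) - 1))"
    by (intro cong_sum) auto
  ultimately show ?thesis by simp
qed

text \<open>A word that is at least as long as all codewords lies in the ideal as soon as one of its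
  continuations does.\<close>

lemma level_generated_mono:
  assumes "reaches (generated Q) (generated Q')" "\<forall>q\<in>Q'. length q \<le> n"
  shows "level n (generated Q) \<subseteq> level n (generated Q')"
proof
  fix x assume "x \<in> level n (generated Q)"
  then have x: "x \<in> generated Q" "length x = n" unfolding level_def by auto
  then obtain w where "x @ w \<in> generated Q'" using assms(1) unfolding reaches_def by blast
  then obtain q v where q: "q \<in> Q'" "x @ w = q @ v" by (elim generatedE)
  then have "length q \<le> length x" using assms(2) x by auto
  then obtain u where "x = q @ u" using q(2) by (metis append_eq_append_conv_if append_take_drop_id)
  then show "x \<in> level n (generated Q')" using q x generatedI unfolding level_def by auto
qed

text \<open>Essentially equal ideals contain the same words of any length beyond that of all
  codewords.\<close>

lemma ess_equal_card_cong:
  fixes Q Q' :: "'a::finite list set"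
  assumes "finite Q" "prefix_code Q" "finite Q'" "prefix_code Q'"
    and "ess_equal (generated Q) (generated Q')" "CARD('a) \<ge> 1"
  shows "[card Q = card Q'] (mod (CARD('a) - 1))"
proof -
  have "finite (length ` (Q \<union> Q'))" using assms by simp
  then obtain n where n: "\<forall>q\<in>Q \<union> Q'. length q \<le> n"
    by (metis finite_nat_set_iff_bounded_le imageI)
  have "level n (generated Q) = level n (generated Q')"
    using level_generated_mono[of Q Q' n] level_generated_mono[of Q' Q n] assms(5) n
    unfolding ess_equal_def by blast
  then show ?thesis
    using card_level_generated[of Q n] card_level_generated[of Q' n] assms n
    by (metis UnCI cong_sym cong_trans)
qed

text \<open>Replacing a codeword q by all its one-letter continuations adds k - 1 codewords, so the
  size of a code can be raised within its residue class.\<close>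

lemma expand_code:
  fixes Q :: "'a::finite list set"
  assumes "finite Q" "prefix_code Q" "Q \<noteq> {}" "CARD('a) \<ge> 1"
  shows "\<exists>Q'. finite Q' \<and> prefix_code Q' \<and> ess_equal (generated Q') (generated Q) \<and>
              card Q' = card Q + j * (CARD('a) - 1)"
proof (induction j)
  case 0
  show ?case using assms by (intro exI[of _ Q]) (simp add: ess_equal_def reaches_subset)
next
  case (Suc j)
  then obtain R where R: "finite R" "prefix_code R" "ess_equal (generated R) (generated Q)"
      "card R = card Q + j * (CARD('a) - 1)" by blast
  have "card Q > 0" using assms by (simp add: card_gt_0_iff)
  then have "card R > 0" using R(4) by linarith
  then obtain q where q: "q \<in> R" by fastforce
  let ?N = "range (\<lambda>a. q @ [a])"
  let ?S = "(R - {q}) \<union> ?N"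
  have cmp: "\<not> prefix r q \<and> \<not> prefix q r" if "r \<in> R - {q}" for r
    using R(2) q that unfolding prefix_code_def by auto
  have "card ?N = CARD('a)" by (intro card_image) (simp add: inj_on_def)
  moreover have "q @ [a] \<notin> R - {q}" for a using cmp[of "q @ [a]"] by auto
  then have "(R - {q}) \<inter> ?N = {}" by auto
  ultimately have "card ?S = card (R - {q}) + CARD('a)"
    using R(1) by (simp add: card_Un_disjoint)
  then have "card ?S = card R + (CARD('a) - 1)"
    using R(1) q assms(4) card_Suc_Diff1[of R q] by simp
  moreover have "finite ?S" using R(1) by simp
  moreover have "prefix_code ?S"
  proof -
    have "x = y" if "x \<in> ?S" "y \<in> ?S" "prefix x y" for x y
      using that
    proof (elim UnE)
      assume "x \<in> R - {q}" "y \<in> R - {q}"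
      then show ?thesis using R(2) that unfolding prefix_code_def by blast
    next
      assume "x \<in> R - {q}" "y \<in> ?N"
      then show ?thesis using cmp[of x] that(3) by (auto simp: prefix_snoc)
    next
      assume "x \<in> ?N" "y \<in> R - {q}"
      then show ?thesis using cmp[of y] that(3) by (auto dest: append_prefixD)
    next
      assume "x \<in> ?N" "y \<in> ?N"
      then show ?thesis using that(3) by auto
    qed
    then show ?thesis unfolding prefix_code_def by blast
  qed
  moreover have "ess_equal (generated ?S) (generated R)"
  proof -
    have "generated ?S \<subseteq> generated R"
    proof
      fix x assume "x \<in> generated ?S"
      then obtain s w where s: "s \<in> ?S" "x = s @ w" by (elim generatedE)
      then obtain r v where "r \<in> R" "s = r @ v" using q by auto
      then show "x \<in> generated R" using s generatedI[of r R "v @ w"] by simp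
    qed
    moreover have "reaches (generated R) (generated ?S)"
      unfolding reaches_def
    proof
      fix x assume "x \<in> generated R"
      then obtain r w where r: "r \<in> R" "x = r @ w" by (elim generatedE)
      show "\<exists>v. x @ v \<in> generated ?S"
      proof (cases "r = q")
        case False
        then have "x @ [] \<in> generated ?S" using r by (auto intro: generatedI)
        then show ?thesis by blast
      next
        case True
        \<comment> \<open>one more letter, in case that w is empty\<close>
        fix a :: 'a
        obtain b u where "w @ [a] = b # u" by (cases "w @ [a]") auto
        then have "x @ [a] = (q @ [b]) @ u" using r True by simp
        moreover have "(q @ [b]) @ u \<in> generated ?S" by (rule generatedI) simp
        ultimately show ?thesis by metis
      qed
    qed
    ultimately show ?thesis by (simp add: ess_equal_def reaches_subset)
  qed
  then have "ess_equal (generated ?S) (generated Q)" using R(3) by (rule ess_equal_trans)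
  moreover have "card ?S = card Q + Suc j * (CARD('a) - 1)"
    unfolding \<open>card ?S = card R + (CARD('a) - 1)\<close> R(4) by (simp only: mult_Suc ac_simps)
  ultimately show ?case by (intro exI[of _ ?S] conjI)
qed

section \<open>Maximal essential extensions\<close>

lemma homD: "right_ideal_hom \<phi> \<Longrightarrow> \<phi> x = Some y \<Longrightarrow> \<phi> (x @ w) = Some (y @ w)"
  unfolding right_ideal_hom_def by blast

lemma homI: "(\<And>x y w. \<phi> x = Some y \<Longrightarrow> \<phi> (x @ w) = Some (y @ w)) \<Longrightarrow> right_ideal_hom \<phi>"
  unfolding right_ideal_hom_def right_ideal_def by (auto simp: dom_def)

lemma hom_dom: "right_ideal_hom \<phi> \<Longrightarrow> right_ideal (dom \<phi>)"
  unfolding right_ideal_hom_def by blast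

lemma hom_ran: "right_ideal_hom \<phi> \<Longrightarrow> right_ideal (ran \<phi>)"
  unfolding right_ideal_def ran_def by (blast dest: homD)

lemma hom_comp:
  assumes "right_ideal_hom \<phi>" "right_ideal_hom \<psi>"
  shows "right_ideal_hom (\<phi> \<circ>\<^sub>m \<psi>)"
  by (rule homI) (auto simp: map_comp_Some_iff intro: homD assms)

text \<open>An essential extension of \<open>\<phi>\<close> that is defined at x with value y exists exactly if \<open>\<phi>\<close>
  maps continuations of x as y prescribes, and such continuations occur below every word
  \<open>x @ w\<close>.\<close>

definition eventually_maps :: "('a list \<rightharpoonup> 'a list) \<Rightarrow> 'a list \<Rightarrow> 'a list \<Rightarrow> bool" where
  "eventually_maps \<phi> x y \<longleftrightarrow> (\<forall>w. \<exists>v. \<phi> (x @ w @ v) = Some (y @ w @ v))"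

definition completion :: "('a list \<rightharpoonup> 'a list) \<Rightarrow> ('a list \<rightharpoonup> 'a list)" where
  "completion \<phi> x = (if \<exists>y. eventually_maps \<phi> x y then Some (THE y. eventually_maps \<phi> x y) else None)"

lemma eventually_maps_unique:
  assumes "right_ideal_hom \<phi>" "eventually_maps \<phi> x y" "eventually_maps \<phi> x z"
  shows "y = z"
proof -
  obtain v where v: "\<phi> (x @ v) = Some (y @ v)"
    using assms(2) unfolding eventually_maps_def by (metis append_Nil)
  obtain u where u: "\<phi> (x @ v @ u) = Some (z @ v @ u)"
    using assms(3) unfolding eventually_maps_def by blast
  show ?thesis using homD[OF assms(1) v, of u] u by simp
qed

lemma completion_iff:
  assumes "right_ideal_hom \<phi>"
  shows "completion \<phi> x = Some y \<longleftrightarrow> eventually_maps \<phi> x y"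
proof -
  have "(THE y. eventually_maps \<phi> x y) = y" if "eventually_maps \<phi> x y" for y
    using that eventually_maps_unique[OF assms] by blast
  then show ?thesis unfolding completion_def by auto
qed

lemma completionD:
  assumes "right_ideal_hom \<phi>" "completion \<phi> x = Some y"
  shows "\<exists>v. \<phi> (x @ v) = Some (y @ v)"
  using assms by (metis completion_iff eventually_maps_def append_Nil)

lemma hom_completion: "right_ideal_hom \<phi> \<Longrightarrow> right_ideal_hom (completion \<phi>)"
  by (rule homI) (simp add: completion_iff eventually_maps_def, metis append.assoc)

lemma completion_extends: "right_ideal_hom \<phi> \<Longrightarrow> \<phi> \<subseteq>\<^sub>m completion \<phi>"
  unfolding map_le_def
  by (auto simp: dom_def) (metis completion_iff eventually_maps_def homD)

lemma completion_extendsD: "right_ideal_hom \<phi> \<Longrightarrow> \<phi> x = Some y \<Longrightarrow> completion \<phi> x = Some y"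
  using completion_extends unfolding map_le_def by (metis domI)

lemma ess_restriction_iff:
  "ess_restriction \<Phi> \<phi> \<longleftrightarrow>
     right_ideal_hom \<Phi> \<and> right_ideal_hom \<phi> \<and> \<Phi> \<subseteq>\<^sub>m \<phi> \<and> reaches (dom \<phi>) (dom \<Phi>)"
  unfolding ess_restriction_def using essential_in_iff hom_dom map_le_implies_dom_le by metis

lemma reaches_dom_completion:
  "right_ideal_hom \<phi> \<Longrightarrow> reaches (dom (completion \<phi>)) (dom \<phi>)"
  unfolding reaches_def by (blast dest: completionD)

lemma completion_maximal:
  assumes "ess_restriction \<phi> \<chi>"
  shows "\<chi> \<subseteq>\<^sub>m completion \<phi>"
proof -
  have h: "right_ideal_hom \<phi>" "right_ideal_hom \<chi>" "\<phi> \<subseteq>\<^sub>m \<chi>" "reaches (dom \<chi>) (dom \<phi>)"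
    using assms unfolding ess_restriction_iff by auto
  have "eventually_maps \<phi> x y" if xy: "\<chi> x = Some y" for x y
    unfolding eventually_maps_def
  proof
    fix w
    have xw: "\<chi> (x @ w) = Some (y @ w)" using homD[OF h(2) xy] .
    then obtain v where v: "(x @ w) @ v \<in> dom \<phi>" using h(4) unfolding reaches_def by blast
    then have "\<phi> ((x @ w) @ v) = \<chi> ((x @ w) @ v)" using h(3) unfolding map_le_def by blast
    then have "\<phi> (x @ w @ v) = Some (y @ w @ v)" using homD[OF h(2) xw, of v] by simp
    then show "\<exists>v. \<phi> (x @ w @ v) = Some (y @ w @ v)" by blast
  qed
  then have "completion \<phi> x = Some y" if "\<chi> x = Some y" for x y
    using that completion_iff[OF h(1)] by blast
  then show ?thesis unfolding map_le_def by (metis domD)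
qed

text \<open>The completion is even the largest essential extension, whence the unique maximal one.\<close>

lemma max_ext_eq_completion:
  assumes "right_ideal_hom \<phi>"
  shows "max_ext \<phi> = completion \<phi>"
proof -
  have e: "ess_restriction \<phi> (completion \<phi>)"
    unfolding ess_restriction_iff
    using assms hom_completion completion_extends reaches_dom_completion by blast
  show ?thesis unfolding max_ext_def
    by (rule the_equality) (use e completion_maximal map_le_antisym in blast)+
qed

text \<open>The completion depends only on the values on an essential subideal. Every identity in the
  monoids is verified by comparing the two sides on such a subideal.\<close>

lemma completion_cong_dense:
  assumes "right_ideal_hom \<phi>" "right_ideal_hom \<psi>" "\<phi> \<subseteq>\<^sub>m \<psi>" "reaches (dom \<psi>) (dom \<phi>)"
  shows "completion \<phi> = completion \<psi>"
proof -
  have "eventually_maps \<phi> x y \<longleftrightarrow> eventually_maps \<psi> x y" for x y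
  proof
    assume "eventually_maps \<phi> x y"
    then show "eventually_maps \<psi> x y"
      using assms(3) unfolding eventually_maps_def map_le_def by (metis domI)
  next
    assume e: "eventually_maps \<psi> x y"
    show "eventually_maps \<phi> x y"
      unfolding eventually_maps_def
    proof
      fix w
      obtain v where v: "\<psi> (x @ w @ v) = Some (y @ w @ v)"
        using e unfolding eventually_maps_def by blast
      then obtain u where u: "(x @ w @ v) @ u \<in> dom \<phi>" using assms(4) unfolding reaches_def by blast
      then have "\<phi> (x @ w @ v @ u) = Some (y @ w @ v @ u)"
        using assms(3) homD[OF assms(2) v, of u] unfolding map_le_def by auto
      then show "\<exists>v. \<phi> (x @ w @ v) = Some (y @ w @ v)" by blast
    qed
  qed
  then have "eventually_maps \<phi> = eventually_maps \<psi>" by (intro ext) blast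
  then show ?thesis by (intro ext) (simp add: completion_def)
qed

lemma completion_idem: "right_ideal_hom \<phi> \<Longrightarrow> completion (completion \<phi>) = completion \<phi>"
  using completion_cong_dense hom_completion completion_extends reaches_dom_completion by metis

lemma completion_comp_left:
  assumes "right_ideal_hom \<phi>" "right_ideal_hom \<psi>"
  shows "completion (completion \<phi> \<circ>\<^sub>m \<psi>) = completion (\<phi> \<circ>\<^sub>m \<psi>)"
proof (rule completion_cong_dense[symmetric])
  show "\<phi> \<circ>\<^sub>m \<psi> \<subseteq>\<^sub>m completion \<phi> \<circ>\<^sub>m \<psi>"
    unfolding map_le_def by (auto simp: map_comp_Some_iff completion_extendsD assms)
  show "reaches (dom (completion \<phi> \<circ>\<^sub>m \<psi>)) (dom (\<phi> \<circ>\<^sub>m \<psi>))"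
    unfolding reaches_def
  proof
    fix x assume "x \<in> dom (completion \<phi> \<circ>\<^sub>m \<psi>)"
    then obtain y z where yz: "\<psi> x = Some y" "completion \<phi> y = Some z"
      by (auto simp: map_comp_Some_iff)
    obtain v where "\<phi> (y @ v) = Some (z @ v)" using completionD[OF assms(1) yz(2)] by blast
    then have "(\<phi> \<circ>\<^sub>m \<psi>) (x @ v) = Some (z @ v)" using homD[OF assms(2) yz(1)] by simp
    then show "\<exists>w. x @ w \<in> dom (\<phi> \<circ>\<^sub>m \<psi>)" by blast
  qed
qed (intro hom_comp hom_completion assms)+

lemma completion_comp_right:
  assumes "right_ideal_hom \<phi>" "right_ideal_hom \<psi>"
  shows "completion (\<phi> \<circ>\<^sub>m completion \<psi>) = completion (\<phi> \<circ>\<^sub>m \<psi>)"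
proof (rule completion_cong_dense[symmetric])
  show "\<phi> \<circ>\<^sub>m \<psi> \<subseteq>\<^sub>m \<phi> \<circ>\<^sub>m completion \<psi>"
    unfolding map_le_def by (auto simp: map_comp_Some_iff completion_extendsD assms)
  show "reaches (dom (\<phi> \<circ>\<^sub>m completion \<psi>)) (dom (\<phi> \<circ>\<^sub>m \<psi>))"
    unfolding reaches_def
  proof
    fix x assume "x \<in> dom (\<phi> \<circ>\<^sub>m completion \<psi>)"
    then obtain y z where yz: "completion \<psi> x = Some y" "\<phi> y = Some z"
      by (auto simp: map_comp_Some_iff)
    obtain v where "\<psi> (x @ v) = Some (y @ v)" using completionD[OF assms(2) yz(1)] by blast
    then have "(\<phi> \<circ>\<^sub>m \<psi>) (x @ v) = Some (z @ v)" using homD[OF assms(1) yz(2)] by simp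
    then show "\<exists>w. x @ w \<in> dom (\<phi> \<circ>\<^sub>m \<psi>)" by blast
  qed
qed (intro hom_comp hom_completion assms)+

lemma inj_completion:
  assumes "right_ideal_hom \<phi>" "inj_on \<phi> (dom \<phi>)"
  shows "inj_on (completion \<phi>) (dom (completion \<phi>))"
proof (rule inj_onI)
  fix x x' assume "x \<in> dom (completion \<phi>)" "completion \<phi> x = completion \<phi> x'"
  then obtain y where y: "completion \<phi> x = Some y" "completion \<phi> x' = Some y" by (metis domD)
  obtain v where v: "\<phi> (x @ v) = Some (y @ v)" using completionD[OF assms(1) y(1)] by blast
  have "completion \<phi> (x' @ v) = Some (y @ v)" using homD[OF hom_completion[OF assms(1)] y(2)] .
  then obtain u where u: "\<phi> ((x' @ v) @ u) = Some ((y @ v) @ u)"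
    using completionD[OF assms(1)] by blast
  have "\<phi> ((x @ v) @ u) = Some ((y @ v) @ u)" using homD[OF assms(1) v] .
  then have "(x @ v) @ u = (x' @ v) @ u" using u assms(2) by (metis domI inj_onD)
  then show "x = x'" by simp
qed

lemma ess_restriction_ran:
  assumes "ess_restriction \<Phi> \<phi>"
  shows "ess_equal (ran \<Phi>) (ran \<phi>)"
proof -
  have h: "right_ideal_hom \<phi>" "\<Phi> \<subseteq>\<^sub>m \<phi>" "reaches (dom \<phi>) (dom \<Phi>)"
    using assms unfolding ess_restriction_iff by auto
  have "ran \<Phi> \<subseteq> ran \<phi>" using h(2) unfolding map_le_def ran_def by (auto, metis domI)
  moreover have "\<exists>w. y @ w \<in> ran \<Phi>" if xy: "\<phi> x = Some y" for x y
  proof -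
    obtain w where "x @ w \<in> dom \<Phi>" using h(3) xy unfolding reaches_def by blast
    then have "\<Phi> (x @ w) = Some (y @ w)" using h(2) homD[OF h(1) xy] unfolding map_le_def by simp
    then show ?thesis unfolding ran_def by blast
  qed
  ultimately show ?thesis
    unfolding ess_equal_def by (auto simp: reaches_subset) (auto simp: reaches_def ran_def)
qed

lemma ran_completion: "right_ideal_hom \<phi> \<Longrightarrow> ess_equal (ran (completion \<phi>)) (ran \<phi>)"
  using ess_restriction_ran ess_equal_sym unfolding ess_restriction_iff
  by (meson completion_extends hom_completion reaches_dom_completion)

section \<open>Finitely generated homomorphisms and tables\<close>

text \<open>Finite generation of the domain, in the form of \<open>fin_gen_iff\<close>. The image is then finitely
  generated, too (\<open>fg_hom_iff\<close>).\<close>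

definition fin_hom :: "('a list \<rightharpoonup> 'a list) \<Rightarrow> bool" where
  "fin_hom \<phi> \<longleftrightarrow> right_ideal_hom \<phi> \<and> (\<exists>n. \<forall>x\<in>dom \<phi>. take n x \<in> dom \<phi>)"

lemma fin_hom_hom: "fin_hom \<phi> \<Longrightarrow> right_ideal_hom \<phi>"
  unfolding fin_hom_def by blast

lemma fin_hom_completion:
  assumes "fin_hom \<phi>" shows "fin_hom (completion \<phi>)"
proof -
  obtain n where h: "right_ideal_hom \<phi>" and n: "\<And>x. x \<in> dom \<phi> \<Longrightarrow> take n x \<in> dom \<phi>"
    using assms unfolding fin_hom_def by blast
  have "take n x \<in> dom (completion \<phi>)" if x: "x \<in> dom (completion \<phi>)" for x
  proof (cases "length x \<le> n")
    case False
    obtain v where "x @ v \<in> dom \<phi>"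
      using reaches_dom_completion[OF h] x unfolding reaches_def by blast
    then have "take n x \<in> dom \<phi>" using n[of "x @ v"] False by simp
    then show ?thesis using map_le_implies_dom_le[OF completion_extends[OF h]] by blast
  qed (use x in simp)
  then show ?thesis unfolding fin_hom_def using hom_completion[OF h] by blast
qed

text \<open>If n bounds the generators of the domain of \<open>\<psi>\<close>, then the image of x is a fixed word
  followed by the part of x beyond n, of which \<open>\<phi>\<close> needs at most m letters.\<close>

lemma fin_hom_comp:
  assumes "fin_hom \<phi>" "fin_hom \<psi>" shows "fin_hom (\<phi> \<circ>\<^sub>m \<psi>)"
proof -
  obtain m where h: "right_ideal_hom \<phi>" and m: "\<And>x. x \<in> dom \<phi> \<Longrightarrow> take m x \<in> dom \<phi>"
    using assms(1) unfolding fin_hom_def by blast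
  obtain n where g: "right_ideal_hom \<psi>" and n: "\<And>x. x \<in> dom \<psi> \<Longrightarrow> take n x \<in> dom \<psi>"
    using assms(2) unfolding fin_hom_def by blast
  have "take (n + m) x \<in> dom (\<phi> \<circ>\<^sub>m \<psi>)" if x: "x \<in> dom (\<phi> \<circ>\<^sub>m \<psi>)" for x
  proof -
    obtain u where "(\<phi> \<circ>\<^sub>m \<psi>) x = Some u" using x by blast
    then obtain y where y: "\<psi> x = Some y" "y \<in> dom \<phi>" by (auto simp: map_comp_Some_iff)
    obtain z where z: "\<psi> (take n x) = Some z" using n y(1) by blast
    have "y = z @ drop n x" using homD[OF g z, of "drop n x"] y(1) by simp
    then have "take m (z @ drop n x) \<in> dom \<phi>" using m[OF y(2)] by (simp only:)
    moreover have "take m (z @ take m (drop n x)) = take m (z @ drop n x)" by simp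
    ultimately have "take m (z @ take m (drop n x)) @ drop m (z @ take m (drop n x)) \<in> dom \<phi>"
      using right_idealD[OF hom_dom[OF h]] by metis
    then have "z @ take m (drop n x) \<in> dom \<phi>" by (simp only: append_take_drop_id)
    then have "\<psi> (take n x @ take m (drop n x)) = Some (z @ take m (drop n x))"
      "z @ take m (drop n x) \<in> dom \<phi>"
      using homD[OF g z] by auto
    then show ?thesis by (auto simp: take_add map_comp_Some_iff)
  qed
  then show ?thesis unfolding fin_hom_def using hom_comp[OF h g] by blast
qed

text \<open>Cutting a finitely generated homomorphism at image length n gives a table onto the words of
  length n in its image: the image words of length n form a prefix code, and the preimage of a
  prefix code is one, too.\<close>

lemma level_preimage_code:
  fixes \<phi> :: "'a::finite list \<rightharpoonup> 'a list"
  assumes "fin_hom \<phi>"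
  shows "\<exists>n0. \<forall>n\<ge>n0. finite {x. \<exists>y. \<phi> x = Some y \<and> length y = n} \<and>
     prefix_code {x. \<exists>y. \<phi> x = Some y \<and> length y = n} \<and>
     generated {x. \<exists>y. \<phi> x = Some y \<and> length y = n} = {x. \<exists>y. \<phi> x = Some y \<and> n \<le> length y}"
proof -
  obtain d where h: "right_ideal_hom \<phi>" and d: "\<And>x. x \<in> dom \<phi> \<Longrightarrow> take d x \<in> dom \<phi>"
    using assms unfolding fin_hom_def by blast
  have split: "\<exists>z. \<phi> (take d x) = Some z \<and> y = z @ drop d x" if xy: "\<phi> x = Some y" for x y
  proof -
    obtain z where z: "\<phi> (take d x) = Some z" using d xy by blast
    then show ?thesis using homD[OF h z, of "drop d x"] xy by simp
  qed
  have "finite ((\<lambda>x. length (the (\<phi> x))) ` {x. length x \<le> d})"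
    using finite_bounded_words by blast
  then obtain n0 where n0: "\<And>x. length x \<le> d \<Longrightarrow> length (the (\<phi> x)) \<le> n0"
    by (metis (mono_tags) finite_nat_set_iff_bounded_le imageI mem_Collect_eq)
  show ?thesis
  proof (intro exI[of _ n0] allI impI)
    fix n assume n: "n0 \<le> n"
    let ?P = "{x. \<exists>y. \<phi> x = Some y \<and> length y = n}"
    have "?P \<subseteq> {x. length x \<le> d + n}"
    proof
      fix x assume "x \<in> ?P"
      then obtain y where y: "\<phi> x = Some y" "length y = n" by blast
      then obtain z where "y = z @ drop d x" using split by blast
      then show "x \<in> {x. length x \<le> d + n}" using y(2) by auto
    qed
    then have "finite ?P" using finite_bounded_words finite_subset by blast
    moreover have "prefix_code ?P"
      unfolding prefix_code_def
    proof (intro ballI impI)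
      fix x x' assume x: "x \<in> ?P" "x' \<in> ?P" "prefix x x'"
      then obtain w where "x' = x @ w" by (elim prefixE)
      moreover obtain y where "\<phi> x = Some y" "length y = n" using x(1) by blast
      ultimately show "x = x'" using homD[OF h, of x y w] x(2) by simp
    qed
    moreover have "x \<in> generated ?P" if xy: "\<phi> x = Some y" "n \<le> length y" for x y
    proof -
      obtain z where z: "\<phi> (take d x) = Some z" "y = z @ drop d x" using split xy by blast
      let ?u = "take (n - length z) (drop d x)"
      have "length z \<le> n" using n0[of "take d x"] z n by simp
      then have "length (z @ ?u) = n" using xy z(2) by simp
      moreover have "\<phi> (take d x @ ?u) = Some (z @ ?u)" using homD[OF h z(1)] .
      ultimately have "(take d x @ ?u) @ drop (n - length z) (drop d x) \<in> generated ?P"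
        by (intro generatedI) blast
      then show ?thesis by (simp only: append.assoc append_take_drop_id)
    qed
    moreover have "generated ?P \<subseteq> {x. \<exists>y. \<phi> x = Some y \<and> n \<le> length y}"
      unfolding generated_def using homD[OF h] by fastforce
    ultimately show "finite ?P \<and> prefix_code ?P \<and>
        generated ?P = {x. \<exists>y. \<phi> x = Some y \<and> n \<le> length y}" by blast
  qed
qed

lemma fin_hom_ran:
  fixes \<phi> :: "'a::finite list \<rightharpoonup> 'a list"
  assumes "fin_hom \<phi>"
  shows "\<exists>n. \<forall>y\<in>ran \<phi>. take n y \<in> ran \<phi>"
proof -
  obtain n where n: "generated {x. \<exists>y. \<phi> x = Some y \<and> length y = n}
      = {x. \<exists>y. \<phi> x = Some y \<and> n \<le> length y}"
    using level_preimage_code[OF assms] by blast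
  have "take n y \<in> ran \<phi>" if xy: "\<phi> x = Some y" for x y
  proof (cases "n \<le> length y")
    case True
    then have "x \<in> generated {x. \<exists>y. \<phi> x = Some y \<and> length y = n}" using n xy by blast
    then obtain p w z where "\<phi> p = Some z" "length z = n" "x = p @ w" by (elim generatedE) blast
    moreover have "y = z @ w"
      using homD[OF fin_hom_hom[OF assms] calculation(1), of w] calculation xy by simp
    ultimately show ?thesis by (simp add: ranI)
  qed (use xy in \<open>simp add: ranI\<close>)
  then show ?thesis unfolding ran_def by blast
qed

lemma fg_hom_iff: "fg_hom \<phi> \<longleftrightarrow> fin_hom (\<phi> :: 'a::finite list \<rightharpoonup> 'a list)"
proof
  assume "fg_hom \<phi>"
  then show "fin_hom \<phi>" unfolding fg_hom_def fin_gen_iff fin_hom_def by blast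
next
  assume \<phi>: "fin_hom \<phi>"
  then have "right_ideal_hom \<phi>" "\<exists>n. \<forall>x\<in>dom \<phi>. take n x \<in> dom \<phi>"
    unfolding fin_hom_def by blast+
  then show "fg_hom \<phi>"
    unfolding fg_hom_def fin_gen_iff using fin_hom_ran[OF \<phi>] hom_dom hom_ran by blast
qed

text \<open>The homomorphism on \<open>generated P\<close> that extends \<open>f\<close>, for a prefix code \<open>P\<close>.\<close>

definition table :: "'a list set \<Rightarrow> ('a list \<Rightarrow> 'a list) \<Rightarrow> ('a list \<rightharpoonup> 'a list)" where
  "table P f x = (if x \<in> generated P
     then let p = THE p. p \<in> P \<and> prefix p x in Some (f p @ drop (length p) x) else None)"

lemma table_append:
  assumes "prefix_code P" "p \<in> P"
  shows "table P f (p @ w) = Some (f p @ w)"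
proof -
  have "(THE q. q \<in> P \<and> prefix q (p @ w)) = p"
  proof (rule the_equality)
    fix q assume "q \<in> P \<and> prefix q (p @ w)"
    then show "q = p" using assms unfolding prefix_code_def
      by (metis prefixI prefix_same_cases)
  qed (use assms in simp)
  then show ?thesis using generatedI[OF assms(2)] by (simp add: table_def)
qed

lemma dom_table: "dom (table P f) = generated P"
  unfolding table_def dom_def by (simp add: Let_def)

lemma table_SomeE:
  assumes "prefix_code P" "table P f x = Some y"
  obtains p w where "p \<in> P" "x = p @ w" "y = f p @ w"
proof -
  have "x \<in> generated P" using assms(2) dom_table by blast
  then obtain p w where "p \<in> P" "x = p @ w" by (elim generatedE)
  then show ?thesis using that assms table_append by fastforce
qed

lemma hom_table:
  assumes "prefix_code P"
  shows "right_ideal_hom (table P f)"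
proof (rule homI)
  fix x y w assume "table P f x = Some y"
  with assms obtain p v where "p \<in> P" "x = p @ v" "y = f p @ v" by (rule table_SomeE)
  then show "table P f (x @ w) = Some (y @ w)" using table_append[OF assms, of p f "v @ w"] by simp
qed

lemma fin_hom_table:
  fixes P :: "'a::finite list set"
  assumes "finite P" "prefix_code P"
  shows "fin_hom (table P f)"
proof -
  have "fin_gen (generated P)" using assms unfolding fin_gen_def by blast
  then show ?thesis
    unfolding fin_hom_def dom_table using fin_gen_iff hom_table assms(2) by blast
qed

lemma table_cancel:
  assumes "prefix_code Q" "prefix_code R" "bij_betw f Q R" "x \<in> generated Q"
  shows "\<exists>y. table Q f x = Some y \<and> table R (inv_into Q f) y = Some x"
proof -
  obtain q w where q: "q \<in> Q" "x = q @ w" using assms(4) by (elim generatedE)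
  then have "f q \<in> R" "inv_into Q f (f q) = q"
    using assms(3) by (auto simp: bij_betw_def)
  then show ?thesis using q table_append[OF assms(1)] table_append[OF assms(2)] by simp
qed

section \<open>Image codes\<close>

lemma is_imC_props:
  assumes "is_imC \<phi> Q"
  shows "finite Q" "prefix_code Q" "ess_equal (generated Q) (ran \<phi>)"
proof -
  obtain \<Phi> P where P: "ess_restriction \<Phi> \<phi>" "dom \<Phi> = generated P"
      "Q = {q. \<exists>p\<in>P. \<Phi> p = Some q}" "finite Q" "prefix_code Q"
    using assms unfolding is_imC_def by blast
  have h: "right_ideal_hom \<Phi>" using P(1) unfolding ess_restriction_iff by blast
  have "ran \<Phi> = generated Q"
  proof
    show "ran \<Phi> \<subseteq> generated Q"
    proof
      fix y assume "y \<in> ran \<Phi>"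
      then obtain x where x: "\<Phi> x = Some y" unfolding ran_def by blast
      then obtain p w where p: "p \<in> P" "x = p @ w" using P(2) by (metis domI generatedE)
      have "p \<in> dom \<Phi>" unfolding P(2) using generatedI[OF p(1), of "[]"] by simp
      then obtain q where q: "\<Phi> p = Some q" by blast
      have "y = q @ w" using homD[OF h q, of w] p(2) x by simp
      moreover have "q \<in> Q" unfolding P(3) using p(1) q by blast
      ultimately show "y \<in> generated Q" by (simp add: generatedI)
    qed
    show "generated Q \<subseteq> ran \<Phi>"
    proof
      fix y assume "y \<in> generated Q"
      then obtain q w where q: "q \<in> Q" "y = q @ w" by (elim generatedE)
      then obtain p where "\<Phi> p = Some q" unfolding P(3) by blast
      then show "y \<in> ran \<Phi>" unfolding q(2) by (intro ranI) (rule homD[OF h])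
    qed
  qed
  then show "ess_equal (generated Q) (ran \<phi>)" using ess_restriction_ran[OF P(1)] by simp
  show "finite Q" "prefix_code Q" using P by auto
qed

lemma is_imC_exists:
  fixes \<phi> :: "'a::finite list \<rightharpoonup> 'a list"
  assumes "fin_hom \<phi>"
  shows "\<exists>Q. is_imC \<phi> Q"
proof -
  obtain n where n: "finite {x. \<exists>y. \<phi> x = Some y \<and> length y = n}"
     "prefix_code {x. \<exists>y. \<phi> x = Some y \<and> length y = n}"
     "generated {x. \<exists>y. \<phi> x = Some y \<and> length y = n} = {x. \<exists>y. \<phi> x = Some y \<and> n \<le> length y}"
    using level_preimage_code[OF assms] by blast
  let ?P = "{x. \<exists>y. \<phi> x = Some y \<and> length y = n}"
  let ?\<Phi> = "\<phi> |` generated ?P"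
  let ?Q = "{q. \<exists>p\<in>?P. ?\<Phi> p = Some q}"
  have h: "right_ideal_hom \<phi>" using assms fin_hom_hom by blast
  have dom: "dom ?\<Phi> = generated ?P" using n(3) by auto
  have "right_ideal_hom ?\<Phi>"
    by (rule homI) (auto simp: restrict_map_def homD[OF h] right_idealD[OF right_ideal_generated]
        split: if_splits)
  moreover have "?\<Phi> \<subseteq>\<^sub>m \<phi>" unfolding map_le_def by simp
  moreover have "reaches (dom \<phi>) (dom ?\<Phi>)"
    unfolding reaches_def
  proof
    fix x assume "x \<in> dom \<phi>"
    then obtain y where y: "\<phi> x = Some y" by blast
    \<comment> \<open>any n letters will do: they only make the image word long enough\<close>
    fix a :: 'a
    have "\<phi> (x @ replicate n a) = Some (y @ replicate n a)" using homD[OF h y] .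
    moreover have "n \<le> length (y @ replicate n a)" by simp
    ultimately have "x @ replicate n a \<in> generated ?P" unfolding n(3) by blast
    then have "x @ replicate n a \<in> dom ?\<Phi>" by (simp only: dom)
    then show "\<exists>w. x @ w \<in> dom ?\<Phi>" by blast
  qed
  ultimately have "ess_restriction ?\<Phi> \<phi>" using h unfolding ess_restriction_iff by blast
  moreover have lq: "length q = n" if q: "q \<in> ?Q" for q
  proof -
    obtain p where "p \<in> ?P" "?\<Phi> p = Some q" using q by blast
    then show ?thesis by (auto simp: restrict_map_def split: if_splits)
  qed
  have "prefix_code ?Q"
    unfolding prefix_code_def
  proof (intro ballI impI)
    fix q r assume "q \<in> ?Q" "r \<in> ?Q" "prefix q r"
    then show "q = r" using lq[of q] lq[of r] by (metis prefix_order.le_less prefix_length_less less_irrefl)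
  qed
  moreover have "finite ?Q"
  proof (rule finite_subset[OF _ finite_bounded_words[of n]], rule subsetI)
    fix q assume "q \<in> ?Q"
    then have "length q = n" by (rule lq)
    then show "q \<in> {x. length x \<le> n}" by simp
  qed
  ultimately have "is_imC \<phi> ?Q" unfolding is_imC_def using n(1,2) dom
    by (intro exI[of _ ?\<Phi>] exI[of _ ?P] conjI refl)
  then show ?thesis by blast
qed

lemma imC_props:
  fixes \<phi> :: "'a::finite list \<rightharpoonup> 'a list"
  assumes "fin_hom \<phi>"
  shows "finite (imC \<phi>)" "prefix_code (imC \<phi>)" "ess_equal (generated (imC \<phi>)) (ran \<phi>)"
  using is_imC_props[OF someI_ex[OF is_imC_exists[OF assms]]] unfolding imC_def by auto

lemma imC_nonempty:
  fixes \<phi> :: "'a::finite list \<rightharpoonup> 'a list"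
  assumes "fin_hom \<phi>" "\<phi> \<noteq> Map.empty"
  shows "imC \<phi> \<noteq> {}"
proof
  assume "imC \<phi> = {}"
  then have "ess_equal {} (ran \<phi>)" using imC_props(3)[OF assms(1)] by (simp add: generated_def)
  then have "ran \<phi> = {}" unfolding ess_equal_def reaches_def by blast
  then have "\<phi> x = None" for x by (cases "\<phi> x") (auto simp: ran_def)
  then show False using assms(2) by auto
qed

section \<open>The monoids\<close>

text \<open>The flag selects between the two monoids. An element is described intrinsically, as a
  finitely generated homomorphism that equals its completion, which makes membership easy to
  check; injectivity can be required of the completed map because completion preserves it.\<close>

definition hom_monoid :: "bool \<Rightarrow> ('a list \<rightharpoonup> 'a list) monoid" where
  "hom_monoid injective = M_k1 \<lparr> carrier :=
     {\<phi>. fin_hom \<phi> \<and> completion \<phi> = \<phi> \<and> (injective \<longrightarrow> inj_on \<phi> (dom \<phi>))} \<rparr>"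

lemma max_ext_image:
  "{max_ext \<phi> | \<phi>. fg_hom \<phi> \<and> (injective \<longrightarrow> inj_on \<phi> (dom \<phi>))} =
   {\<phi> :: 'a::finite list \<rightharpoonup> 'a list. fin_hom \<phi> \<and> completion \<phi> = \<phi> \<and> (injective \<longrightarrow> inj_on \<phi> (dom \<phi>))}"
  (is "?A = ?B")
proof
  show "?A \<subseteq> ?B"
    by (auto simp: fg_hom_iff max_ext_eq_completion fin_hom_hom fin_hom_completion completion_idem
        inj_completion)
  show "?B \<subseteq> ?A"
  proof
    fix \<phi> assume "\<phi> \<in> ?B"
    then have "fg_hom \<phi>" "injective \<longrightarrow> inj_on \<phi> (dom \<phi>)" "\<phi> = max_ext \<phi>"
      by (auto simp: fg_hom_iff max_ext_eq_completion fin_hom_hom)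
    then show "\<phi> \<in> ?A" by blast
  qed
qed

lemma M_k1_eq: "M_k1 = (hom_monoid False :: ('a::finite list \<rightharpoonup> 'a list) monoid)"
  using max_ext_image[of False] by (simp add: hom_monoid_def M_k1_def)

lemma Inv_k1_eq: "Inv_k1 = (hom_monoid True :: ('a::finite list \<rightharpoonup> 'a list) monoid)"
  unfolding Inv_k1_def hom_monoid_def
  using max_ext_image[where 'a = 'a, of True] by (simp only: simp_thms)

lemma carrier_hom_monoid:
  "\<phi> \<in> carrier (hom_monoid injective) \<longleftrightarrow>
     fin_hom \<phi> \<and> completion \<phi> = \<phi> \<and> (injective \<longrightarrow> inj_on \<phi> (dom \<phi>))"
  by (simp add: hom_monoid_def)

lemma mult_hom_monoid:
  "right_ideal_hom \<phi> \<Longrightarrow> right_ideal_hom \<psi> \<Longrightarrow>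
     \<phi> \<otimes>\<^bsub>hom_monoid injective\<^esub> \<psi> = completion (\<phi> \<circ>\<^sub>m \<psi>)"
  by (simp add: hom_monoid_def M_k1_def max_ext_eq_completion hom_comp)

lemma one_hom_monoid: "\<one>\<^bsub>hom_monoid injective\<^esub> = Some"
  by (simp add: hom_monoid_def M_k1_def)

lemma completion_in_carrier:
  assumes "fin_hom \<phi>" "injective \<Longrightarrow> inj_on \<phi> (dom \<phi>)"
  shows "completion \<phi> \<in> carrier (hom_monoid injective)"
  using assms by (simp add: carrier_hom_monoid fin_hom_completion completion_idem fin_hom_hom inj_completion)

lemma inj_map_comp:
  assumes "inj_on \<phi> (dom \<phi>)" "inj_on \<psi> (dom \<psi>)"
  shows "inj_on (\<phi> \<circ>\<^sub>m \<psi>) (dom (\<phi> \<circ>\<^sub>m \<psi>))"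
  using assms unfolding inj_on_def
  by (auto simp: map_comp_Some_iff dom_def)

lemma total_completion:
  assumes "right_ideal_hom \<phi>" "dom \<phi> = UNIV"
  shows "completion \<phi> = \<phi>"
  using completion_extends[OF assms(1)] assms(2) unfolding map_le_def by auto

lemma Some_in_carrier: "Some \<in> carrier (hom_monoid injective)"
proof -
  have "right_ideal_hom Some" by (rule homI) simp
  then show ?thesis
    by (auto simp: carrier_hom_monoid fin_hom_def total_completion inj_on_def)
qed

lemma monoid_hom_monoid: "monoid (hom_monoid injective :: ('a list \<rightharpoonup> 'a list) monoid)"
proof (rule monoidI, unfold one_hom_monoid)
  fix \<phi> \<psi> :: "'a list \<rightharpoonup> 'a list"
  assume "\<phi> \<in> carrier (hom_monoid injective)" "\<psi> \<in> carrier (hom_monoid injective)"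
  then show "\<phi> \<otimes>\<^bsub>hom_monoid injective\<^esub> \<psi> \<in> carrier (hom_monoid injective)"
    by (simp add: mult_hom_monoid fin_hom_hom carrier_hom_monoid[of \<phi>] carrier_hom_monoid[of \<psi>]
        completion_in_carrier fin_hom_comp inj_map_comp)
next
  show "Some \<in> carrier (hom_monoid injective)" by (rule Some_in_carrier)
next
  fix \<phi> \<psi> \<chi> :: "'a list \<rightharpoonup> 'a list"
  assume "\<phi> \<in> carrier (hom_monoid injective)" "\<psi> \<in> carrier (hom_monoid injective)"
    "\<chi> \<in> carrier (hom_monoid injective)"
  then have h: "right_ideal_hom \<phi>" "right_ideal_hom \<psi>" "right_ideal_hom \<chi>"
    by (auto simp: carrier_hom_monoid fin_hom_hom)
  have "(\<phi> \<circ>\<^sub>m \<psi>) \<circ>\<^sub>m \<chi> = \<phi> \<circ>\<^sub>m (\<psi> \<circ>\<^sub>m \<chi>)"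
    by (rule ext) (simp add: map_comp_def split: option.splits)
  then show "\<phi> \<otimes>\<^bsub>hom_monoid injective\<^esub> \<psi> \<otimes>\<^bsub>hom_monoid injective\<^esub> \<chi>
      = \<phi> \<otimes>\<^bsub>hom_monoid injective\<^esub> (\<psi> \<otimes>\<^bsub>hom_monoid injective\<^esub> \<chi>)"
    by (simp add: mult_hom_monoid h hom_comp hom_completion completion_comp_left completion_comp_right)
next
  fix \<phi> :: "'a list \<rightharpoonup> 'a list"
  assume \<phi>: "\<phi> \<in> carrier (hom_monoid injective)"
  have h: "right_ideal_hom Some" by (rule homI) simp
  have "\<phi> \<circ>\<^sub>m Some = \<phi>" "Some \<circ>\<^sub>m \<phi> = \<phi>"
    by (rule ext, simp add: map_comp_def split: option.splits)+
  then show "Some \<otimes>\<^bsub>hom_monoid injective\<^esub> \<phi> = \<phi>" "\<phi> \<otimes>\<^bsub>hom_monoid injective\<^esub> Some = \<phi>"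
    using \<phi> by (simp_all add: mult_hom_monoid h carrier_hom_monoid fin_hom_hom)
qed

lemma (in monoid) green_R_iff:
  "(x, y) \<in> green_R G \<longleftrightarrow> x \<in> carrier G \<and> y \<in> carrier G \<and>
     (\<exists>u\<in>carrier G. x = y \<otimes> u) \<and> (\<exists>v\<in>carrier G. y = x \<otimes> v)"
proof (intro iffI)
  assume "(x, y) \<in> green_R G"
  then have h: "x \<in> carrier G" "y \<in> carrier G" "x <# carrier G = y <# carrier G"
    unfolding green_R_def by auto
  have "x \<in> x <# carrier G" "y \<in> y <# carrier G"
    using h(1,2) unfolding l_coset_def by (force intro!: bexI[of _ \<one>])+
  then have "x \<in> y <# carrier G" "y \<in> x <# carrier G" using h(3) by simp_all
  then show "x \<in> carrier G \<and> y \<in> carrier G \<and>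
     (\<exists>u\<in>carrier G. x = y \<otimes> u) \<and> (\<exists>v\<in>carrier G. y = x \<otimes> v)"
    using h(1,2) unfolding l_coset_def by auto
next
  assume "x \<in> carrier G \<and> y \<in> carrier G \<and>
     (\<exists>u\<in>carrier G. x = y \<otimes> u) \<and> (\<exists>v\<in>carrier G. y = x \<otimes> v)"
  then obtain u v where h: "x \<in> carrier G" "y \<in> carrier G" "u \<in> carrier G" "v \<in> carrier G"
    "x = y \<otimes> u" "y = x \<otimes> v" by blast
  have "x <# carrier G \<subseteq> y <# carrier G"
    using h(1-4) unfolding l_coset_def h(5) by (auto simp: m_assoc intro!: bexI)
  moreover have "y <# carrier G \<subseteq> x <# carrier G"
    using h(1-4) unfolding l_coset_def h(6) by (auto simp: m_assoc intro!: bexI)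
  ultimately show "(x, y) \<in> green_R G" using h(1,2) unfolding green_R_def by blast
qed

lemma (in monoid) green_L_iff:
  "(x, y) \<in> green_L G \<longleftrightarrow> x \<in> carrier G \<and> y \<in> carrier G \<and>
     (\<exists>u\<in>carrier G. x = u \<otimes> y) \<and> (\<exists>v\<in>carrier G. y = v \<otimes> x)"
proof (intro iffI)
  assume "(x, y) \<in> green_L G"
  then have h: "x \<in> carrier G" "y \<in> carrier G" "carrier G #> x = carrier G #> y"
    unfolding green_L_def by auto
  have "x \<in> carrier G #> x" "y \<in> carrier G #> y"
    using h(1,2) unfolding r_coset_def by (force intro!: bexI[of _ \<one>])+
  then have "x \<in> carrier G #> y" "y \<in> carrier G #> x" using h(3) by simp_all
  then show "x \<in> carrier G \<and> y \<in> carrier G \<and>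
     (\<exists>u\<in>carrier G. x = u \<otimes> y) \<and> (\<exists>v\<in>carrier G. y = v \<otimes> x)"
    using h(1,2) unfolding r_coset_def by auto
next
  assume "x \<in> carrier G \<and> y \<in> carrier G \<and>
     (\<exists>u\<in>carrier G. x = u \<otimes> y) \<and> (\<exists>v\<in>carrier G. y = v \<otimes> x)"
  then obtain u v where h: "x \<in> carrier G" "y \<in> carrier G" "u \<in> carrier G" "v \<in> carrier G"
    "x = u \<otimes> y" "y = v \<otimes> x" by blast
  have "carrier G #> x \<subseteq> carrier G #> y"
    using h(1-4) unfolding r_coset_def h(5) by (auto simp: m_assoc[symmetric] intro!: bexI)
  moreover have "carrier G #> y \<subseteq> carrier G #> x"
    using h(1-4) unfolding r_coset_def h(6) by (auto simp: m_assoc[symmetric] intro!: bexI)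
  ultimately show "(x, y) \<in> green_L G" using h(1,2) unfolding green_L_def by blast
qed

section \<open>D-related elements have congruent image codes\<close>

lemma green_R_ess_equal_ran:
  assumes "(\<phi>, \<psi>) \<in> green_R (hom_monoid injective)"
  shows "ess_equal (ran \<phi>) (ran \<psi>)"
proof -
  have *: "reaches (ran (\<phi> \<otimes>\<^bsub>hom_monoid injective\<^esub> \<chi>)) (ran \<phi>)"
    if "\<phi> \<in> carrier (hom_monoid injective)" "\<chi> \<in> carrier (hom_monoid injective)" for \<phi> \<chi> :: "'a list \<rightharpoonup> 'a list"
  proof -
    have h: "right_ideal_hom \<phi>" "right_ideal_hom \<chi>"
      using that by (auto simp: carrier_hom_monoid fin_hom_hom)
    have "ran (\<phi> \<circ>\<^sub>m \<chi>) \<subseteq> ran \<phi>" unfolding ran_def by (auto simp: map_comp_Some_iff)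
    then show ?thesis
      using ran_completion[OF hom_comp[OF h]] reaches_trans reaches_subset
      unfolding ess_equal_def mult_hom_monoid[OF h] by blast
  qed
  interpret monoid "hom_monoid injective" by (rule monoid_hom_monoid)
  show ?thesis using assms * unfolding green_R_iff ess_equal_def by metis
qed

text \<open>Let \<open>T\<close> be the words of length n in the ideal of \<open>Q\<close>, with n beyond the generators of
  the domain of \<open>\<alpha>\<close>. Then \<open>\<alpha>\<close> is defined on \<open>T\<close>, and since \<open>\<beta>\<close> undoes it, no value of \<open>\<alpha>\<close> on
  \<open>T\<close> is a prefix of another. So the image of \<open>T\<close> is a prefix code of the size of \<open>T\<close>, and it
  generates \<open>J\<close> up to essential equality.\<close>

lemma card_cong_of_mutual_inverse:
  fixes Q Q' I J :: "'a::finite list set"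
  assumes Q: "finite Q" "prefix_code Q" "ess_equal (generated Q) I"
    and Q': "finite Q'" "prefix_code Q'" "ess_equal (generated Q') J"
    and \<alpha>: "fin_hom \<alpha>" and \<beta>: "right_ideal_hom \<beta>"
    and \<alpha>\<beta>: "\<And>y. y \<in> I \<Longrightarrow> \<exists>v z. \<alpha> (y @ v) = Some z \<and> \<beta> z = Some (y @ v) \<and> z \<in> J"
    and \<beta>\<alpha>: "\<And>z. z \<in> J \<Longrightarrow> \<exists>v y. \<beta> (z @ v) = Some y \<and> \<alpha> y = Some (z @ v) \<and> y \<in> I"
    and card: "CARD('a) \<ge> 1"
  shows "[card Q = card Q'] (mod (CARD('a) - 1))"
proof -
  obtain m where h: "right_ideal_hom \<alpha>" and m: "\<And>x. x \<in> dom \<alpha> \<Longrightarrow> take m x \<in> dom \<alpha>"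
    using \<alpha> unfolding fin_hom_def by blast
  obtain l where l: "\<forall>q\<in>Q. length q \<le> l"
    using Q(1) by (metis finite_nat_set_iff_bounded_le finite_imageI imageI)
  define n where "n = max m l"
  have ln: "\<forall>q\<in>Q. length q \<le> n" using l unfolding n_def by auto
  define T where "T = level n (generated Q)"
  have finT: "finite T"
    by (rule finite_subset[OF _ finite_bounded_words[of n]]) (auto simp: T_def level_def)
  have T_I: "\<exists>w. t @ u @ w \<in> I" if "t \<in> T" for t u
  proof -
    have "t @ u \<in> generated Q" using that right_idealD[OF right_ideal_generated] by (auto simp: T_def level_def)
    then show ?thesis using Q(3) unfolding ess_equal_def reaches_def by (metis append.assoc)
  qed
  have T_inv: "\<exists>w z. \<alpha> (t @ u @ w) = Some z \<and> \<beta> z = Some (t @ u @ w) \<and> z \<in> J" if t: "t \<in> T" for t u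
  proof -
    obtain w where "(t @ u @ w) \<in> I" using T_I[OF t] by blast
    then obtain v z where "\<alpha> ((t @ u @ w) @ v) = Some z \<and> \<beta> z = Some ((t @ u @ w) @ v) \<and> z \<in> J"
      using \<alpha>\<beta> by blast
    then show ?thesis by (intro exI[of _ "w @ v"] exI[of _ z]) simp
  qed
  have T_dom: "\<exists>z. \<alpha> t = Some z" if t: "t \<in> T" for t
  proof -
    obtain w z where "\<alpha> (t @ [] @ w) = Some z" using T_inv[OF t] by blast
    then have "take m (t @ w) \<in> dom \<alpha>" by (intro m) auto
    moreover have "m \<le> length t" using t unfolding T_def level_def n_def by simp
    ultimately have "take m t \<in> dom \<alpha>" by simp
    then have "take m t @ drop m t \<in> dom \<alpha>" by (rule right_idealD[OF hom_dom[OF h]])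
    then show ?thesis by auto
  qed
  define f where "f t = the (\<alpha> t)" for t
  have f: "\<alpha> t = Some (f t)" if "t \<in> T" for t using T_dom[OF that] unfolding f_def by auto
  have f_prefix: "t = t'" if t: "t \<in> T" and t': "t' \<in> T" and p: "f t = f t' @ u" for t t' u
  proof -
    \<comment> \<open>after a common continuation, \<open>\<beta>\<close> recovers both arguments from the one value\<close>
    obtain w z where z: "\<alpha> (t @ [] @ w) = Some z" "\<beta> z = Some (t @ [] @ w)"
      using T_inv[OF t] by blast
    obtain w' z' where z': "\<alpha> (t' @ (u @ w) @ w') = Some z'" "\<beta> z' = Some (t' @ (u @ w) @ w')"
      using T_inv[OF t'] by blast
    have "z = f t @ w" using homD[OF h f[OF t], of w] z by simp
    moreover have "z' = f t' @ u @ w @ w'" using homD[OF h f[OF t'], of "u @ w @ w'"] z' by simp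
    ultimately have "z' = z @ w'" using p by simp
    then have "t' @ u @ w @ w' = t @ w @ w'" using homD[OF \<beta> z(2), of w'] z' by simp
    moreover have "length t = length t'" using t t' unfolding T_def level_def by simp
    ultimately show ?thesis by simp
  qed
  have "inj_on f T" by (rule inj_onI) (use f_prefix[of _ _ "[]"] in simp)
  then have cardU: "card (f ` T) = card T" by (rule card_image)
  have "prefix_code (f ` T)"
    unfolding prefix_code_def
  proof (intro ballI impI)
    fix y y' assume y: "y \<in> f ` T" "y' \<in> f ` T" "prefix y y'"
    then obtain t t' where "t \<in> T" "t' \<in> T" "y = f t" "y' = f t'" by blast
    moreover obtain u where "y' = y @ u" using y(3) by (elim prefixE)
    ultimately show "y = y'" using f_prefix[of t' t u] by simp
  qed
  moreover have "ess_equal (generated (f ` T)) J"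
    unfolding ess_equal_def reaches_def
  proof (intro conjI ballI)
    fix x assume "x \<in> generated (f ` T)"
    then obtain t w where t: "t \<in> T" "x = f t @ w" by (elim generatedE) blast
    obtain v z where v: "\<alpha> (t @ w @ v) = Some z" "z \<in> J" using T_inv[OF t(1)] by blast
    have "z = x @ v" using homD[OF h f[OF t(1)], of "w @ v"] v t by simp
    then show "\<exists>w. x @ w \<in> J" using v by blast
  next
    fix z assume "z \<in> J"
    then obtain v y where y: "\<alpha> y = Some (z @ v)" "y \<in> I" using \<beta>\<alpha> by blast
    then obtain u where "y @ u \<in> generated Q" using Q(3) unfolding ess_equal_def reaches_def by blast
    then obtain q r where q: "q \<in> Q" "y @ u = q @ r" by (elim generatedE)
    \<comment> \<open>the padding makes \<open>q @ s\<close> long enough to have a prefix in \<open>T\<close>\<close>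
    fix a :: 'a
    define s where "s = r @ replicate n a"
    have T: "q @ take (n - length q) s \<in> T"
      using q ln by (auto simp: T_def level_def s_def intro: generatedI)
    then have "f (q @ take (n - length q) s) @ drop (n - length q) s \<in> generated (f ` T)"
      by (auto intro: generatedI)
    moreover have "\<alpha> (q @ take (n - length q) s @ drop (n - length q) s)
        = Some (f (q @ take (n - length q) s) @ drop (n - length q) s)"
      using homD[OF h f[OF T], of "drop (n - length q) s"] by (simp only: append.assoc)
    moreover have "q @ take (n - length q) s @ drop (n - length q) s = y @ u @ replicate n a"
      unfolding append_take_drop_id s_def using q(2) by (metis append.assoc)
    ultimately have "(z @ v) @ u @ replicate n a \<in> generated (f ` T)"
      using homD[OF h y(1), of "u @ replicate n a"] by simp
    then show "\<exists>w. z @ w \<in> generated (f ` T)" by (metis append.assoc)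
  qed
  then have "ess_equal (generated (f ` T)) (generated Q')"
    using Q'(3) ess_equal_sym ess_equal_trans by blast
  ultimately have "[card (f ` T) = card Q'] (mod (CARD('a) - 1))"
    using ess_equal_card_cong[of "f ` T" Q'] finT Q' card by blast
  moreover have "[card T = card Q] (mod (CARD('a) - 1))"
    unfolding T_def using card_level_generated[OF Q(1,2) ln card] .
  ultimately show ?thesis using cardU by (metis cong_sym cong_trans)
qed

text \<open>If \<open>\<psi> = \<alpha> \<phi>\<close> and \<open>\<phi> = \<beta> \<psi>\<close>, then \<open>\<alpha>\<close> and \<open>\<beta>\<close> are mutually inverse between the images
  of \<open>\<phi>\<close> and \<open>\<psi>\<close>, up to essential equality.\<close>

lemma left_multiple_inverse:
  assumes "right_ideal_hom \<phi>" "right_ideal_hom \<psi>" "right_ideal_hom \<alpha>" "right_ideal_hom \<beta>"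
    and "\<psi> = completion (\<alpha> \<circ>\<^sub>m \<phi>)" "\<phi> = completion (\<beta> \<circ>\<^sub>m \<psi>)" "y \<in> ran \<phi>"
  shows "\<exists>v z. \<alpha> (y @ v) = Some z \<and> \<beta> z = Some (y @ v) \<and> z \<in> ran \<psi>"
proof -
  obtain x where x: "\<phi> x = Some y" using assms(7) unfolding ran_def by blast
  then have "completion (\<beta> \<circ>\<^sub>m \<psi>) x = Some y" using assms(6) by simp
  then obtain v where "(\<beta> \<circ>\<^sub>m \<psi>) (x @ v) = Some (y @ v)"
    using completionD[OF hom_comp[OF assms(4,2)]] by blast
  then obtain z where z: "\<psi> (x @ v) = Some z" "\<beta> z = Some (y @ v)"
    by (auto simp: map_comp_Some_iff)
  then have "completion (\<alpha> \<circ>\<^sub>m \<phi>) (x @ v) = Some z" using assms(5) by simp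
  then obtain u where "(\<alpha> \<circ>\<^sub>m \<phi>) ((x @ v) @ u) = Some (z @ u)"
    using completionD[OF hom_comp[OF assms(3,1)]] by blast
  moreover have "\<phi> ((x @ v) @ u) = Some (y @ v @ u)" using homD[OF assms(1) x, of "v @ u"] by simp
  ultimately have "\<alpha> (y @ v @ u) = Some (z @ u)" by simp
  moreover have "\<beta> (z @ u) = Some (y @ v @ u)" using homD[OF assms(4) z(2), of u] by simp
  moreover have "z @ u \<in> ran \<psi>" using homD[OF assms(2) z(1), of u] by (rule ranI)
  ultimately show ?thesis by blast
qed

lemma green_L_card_cong:
  fixes \<phi> \<psi> :: "'a::finite list \<rightharpoonup> 'a list"
  assumes "(\<phi>, \<psi>) \<in> green_L (hom_monoid injective)" "CARD('a) \<ge> 1"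
  shows "[card (imC \<phi>) = card (imC \<psi>)] (mod (CARD('a) - 1))"
proof -
  interpret monoid "hom_monoid injective :: ('a list \<rightharpoonup> 'a list) monoid" by (rule monoid_hom_monoid)
  obtain \<alpha> \<beta> where c: "\<phi> \<in> carrier (hom_monoid injective)" "\<psi> \<in> carrier (hom_monoid injective)"
      "\<alpha> \<in> carrier (hom_monoid injective)" "\<beta> \<in> carrier (hom_monoid injective)"
      "\<psi> = \<alpha> \<otimes>\<^bsub>hom_monoid injective\<^esub> \<phi>" "\<phi> = \<beta> \<otimes>\<^bsub>hom_monoid injective\<^esub> \<psi>"
    using assms(1) unfolding green_L_iff by blast
  have f: "fin_hom \<phi>" "fin_hom \<psi>" "fin_hom \<alpha>" "fin_hom \<beta>"
    using c(1-4) by (simp_all add: carrier_hom_monoid)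
  note h = f[THEN fin_hom_hom]
  have e: "\<psi> = completion (\<alpha> \<circ>\<^sub>m \<phi>)" "\<phi> = completion (\<beta> \<circ>\<^sub>m \<psi>)"
    using c(5,6) unfolding mult_hom_monoid[OF h(3,1)] mult_hom_monoid[OF h(4,2)] by this+
  show ?thesis
    by (rule card_cong_of_mutual_inverse[OF imC_props[OF f(1)] imC_props[OF f(2)]
        f(3) h(4)
        left_multiple_inverse[OF h(1,2,3,4) e] left_multiple_inverse[OF h(2,1,4,3) e(2,1)] assms(2)])
qed

lemma green_D_card_cong:
  fixes \<phi> \<psi> :: "'a::finite list \<rightharpoonup> 'a list"
  assumes "(\<phi>, \<psi>) \<in> green_D (hom_monoid injective)" "CARD('a) \<ge> 1"
  shows "[card (imC \<phi>) = card (imC \<psi>)] (mod (CARD('a) - 1))"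
proof -
  obtain \<sigma> where \<sigma>: "(\<phi>, \<sigma>) \<in> green_R (hom_monoid injective)" "(\<sigma>, \<psi>) \<in> green_L (hom_monoid injective)"
    using assms(1) unfolding green_D_def by blast
  have "fin_hom \<phi>" "fin_hom \<sigma>"
    using \<sigma>(1) by (auto simp: green_R_def carrier_hom_monoid)
  note p = imC_props[OF this(1)] imC_props[OF this(2)]
  have "ess_equal (generated (imC \<phi>)) (generated (imC \<sigma>))"
    using green_R_ess_equal_ran[OF \<sigma>(1)] p ess_equal_sym ess_equal_trans by blast
  then have "[card (imC \<phi>) = card (imC \<sigma>)] (mod (CARD('a) - 1))"
    using ess_equal_card_cong p assms(2) by blast
  then show ?thesis using green_L_card_cong[OF \<sigma>(2) assms(2)] cong_trans by blast
qed

section \<open>Congruent image codes make elements D-related\<close>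

text \<open>Cut \<open>\<sigma>\<close> so deep that all its image words lie in the image of \<open>\<phi>\<close>, and choose a
  \<open>\<phi>\<close>-preimage for the value at each codeword. The chosen factor is injective with \<open>\<sigma>\<close>, since
  \<open>\<sigma>\<close> factors through it.\<close>

lemma factor_through:
  fixes \<phi> \<sigma> :: "'a::finite list \<rightharpoonup> 'a list"
  assumes "fin_hom \<phi>" "fin_hom \<sigma>" "reaches (ran \<sigma>) (ran \<phi>)"
  shows "\<exists>\<chi>. fin_hom \<chi> \<and> completion (\<phi> \<circ>\<^sub>m \<chi>) = completion \<sigma> \<and>
             (inj_on \<sigma> (dom \<sigma>) \<longrightarrow> inj_on \<chi> (dom \<chi>))"
proof -
  have h: "right_ideal_hom \<phi>" "right_ideal_hom \<sigma>" using assms fin_hom_hom by auto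
  obtain m where m: "\<And>y. y \<in> ran \<phi> \<Longrightarrow> take m y \<in> ran \<phi>" using fin_hom_ran[OF assms(1)] by blast
  obtain n0 where n0: "\<forall>n\<ge>n0. finite {x. \<exists>y. \<sigma> x = Some y \<and> length y = n} \<and>
     prefix_code {x. \<exists>y. \<sigma> x = Some y \<and> length y = n} \<and>
     generated {x. \<exists>y. \<sigma> x = Some y \<and> length y = n} = {x. \<exists>y. \<sigma> x = Some y \<and> n \<le> length y}"
    using level_preimage_code[OF assms(2)] by blast
  define n where "n = max n0 m"
  define P where "P = {x. \<exists>y. \<sigma> x = Some y \<and> length y = n}"
  have P: "finite P" "prefix_code P" "generated P = {x. \<exists>y. \<sigma> x = Some y \<and> n \<le> length y}"
    using n0 unfolding P_def n_def by auto
  have "\<exists>u. \<phi> u = \<sigma> p" if p: "p \<in> P" for p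
  proof -
    obtain y where y: "\<sigma> p = Some y" "length y = n" using p unfolding P_def by blast
    then obtain w where "y @ w \<in> ran \<phi>" using assms(3) unfolding reaches_def by (meson ranI)
    then have "take m (y @ w) \<in> ran \<phi>" by (rule m)
    then have "take m y \<in> ran \<phi>" using y(2) by (simp add: n_def)
    then have "take m y @ drop m y \<in> ran \<phi>" by (rule right_idealD[OF hom_ran[OF h(1)]])
    then show ?thesis using y(1) by (auto simp: ran_def)
  qed
  then obtain g where g: "\<And>p. p \<in> P \<Longrightarrow> \<phi> (g p) = \<sigma> p" by metis
  define \<chi> where "\<chi> = table P g"
  have \<chi>: "\<exists>y. \<chi> x = Some y \<and> \<phi> y = \<sigma> x \<and> \<sigma> x \<noteq> None" if x: "x \<in> dom \<chi>" for x
  proof -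
    have "x \<in> generated P" using x unfolding \<chi>_def dom_table .
    then obtain p w where p: "p \<in> P" "x = p @ w" "\<chi> x = Some (g p @ w)"
      unfolding \<chi>_def using table_append[OF P(2)] by (elim generatedE) blast
    obtain y where y: "\<sigma> p = Some y" using p(1) unfolding P_def by blast
    then have "\<phi> (g p @ w) = Some (y @ w)" "\<sigma> x = Some (y @ w)"
      using g[OF p(1)] homD[OF h(1)] homD[OF h(2)] p(2) by auto
    then show ?thesis using p(3) by simp
  qed
  have fin: "fin_hom \<chi>" unfolding \<chi>_def using fin_hom_table P by blast
  have "completion (\<phi> \<circ>\<^sub>m \<chi>) = completion \<sigma>"
  proof (rule completion_cong_dense)
    show "right_ideal_hom (\<phi> \<circ>\<^sub>m \<chi>)" using hom_comp h fin fin_hom_hom by blast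
    show "right_ideal_hom \<sigma>" by (rule h)
    show "\<phi> \<circ>\<^sub>m \<chi> \<subseteq>\<^sub>m \<sigma>"
      unfolding map_le_def
    proof
      fix x assume "x \<in> dom (\<phi> \<circ>\<^sub>m \<chi>)"
      then have "x \<in> dom \<chi>" by (auto simp: map_comp_def split: option.splits)
      then show "(\<phi> \<circ>\<^sub>m \<chi>) x = \<sigma> x" using \<chi> by fastforce
    qed
    show "reaches (dom \<sigma>) (dom (\<phi> \<circ>\<^sub>m \<chi>))"
      unfolding reaches_def
    proof
      fix x assume "x \<in> dom \<sigma>"
      then obtain y where y: "\<sigma> x = Some y" by blast
      fix a :: 'a
      have "\<sigma> (x @ replicate n a) = Some (y @ replicate n a)" by (rule homD[OF h(2) y])
      moreover have "n \<le> length (y @ replicate n a)" by simp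
      ultimately have "x @ replicate n a \<in> dom \<chi>" unfolding \<chi>_def dom_table P(3) by blast
      then have "x @ replicate n a \<in> dom (\<phi> \<circ>\<^sub>m \<chi>)" using \<chi> by fastforce
      then show "\<exists>w. x @ w \<in> dom (\<phi> \<circ>\<^sub>m \<chi>)" by blast
    qed
  qed
  moreover have "inj_on \<chi> (dom \<chi>)" if inj: "inj_on \<sigma> (dom \<sigma>)"
  proof (rule inj_onI)
    fix x x' assume x: "x \<in> dom \<chi>" "x' \<in> dom \<chi>" "\<chi> x = \<chi> x'"
    then have "\<sigma> x = \<sigma> x'" "x \<in> dom \<sigma>" "x' \<in> dom \<sigma>" using \<chi>[OF x(1)] \<chi>[OF x(2)] by auto
    then show "x = x'" using inj by (simp add: inj_on_def)
  qed
  ultimately show ?thesis using fin by blast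
qed

lemma ess_equal_ran_green_R:
  fixes \<phi> \<psi> :: "'a::finite list \<rightharpoonup> 'a list"
  assumes "\<phi> \<in> carrier (hom_monoid injective)" "\<psi> \<in> carrier (hom_monoid injective)"
    and "ess_equal (ran \<phi>) (ran \<psi>)"
  shows "(\<phi>, \<psi>) \<in> green_R (hom_monoid injective)"
proof -
  interpret monoid "hom_monoid injective :: ('a list \<rightharpoonup> 'a list) monoid" by (rule monoid_hom_monoid)
  have *: "\<exists>u\<in>carrier (hom_monoid injective). \<sigma> = \<phi> \<otimes>\<^bsub>hom_monoid injective\<^esub> u"
    if A: "\<phi> \<in> carrier (hom_monoid injective)" "\<sigma> \<in> carrier (hom_monoid injective)"
      "reaches (ran \<sigma>) (ran \<phi>)" for \<phi> \<sigma> :: "'a list \<rightharpoonup> 'a list"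
  proof -
    have c: "fin_hom \<phi>" "fin_hom \<sigma>" "completion \<sigma> = \<sigma>" "injective \<longrightarrow> inj_on \<sigma> (dom \<sigma>)"
      using A by (auto simp: carrier_hom_monoid)
    obtain \<chi> where \<chi>: "fin_hom \<chi>" "completion (\<phi> \<circ>\<^sub>m \<chi>) = \<sigma>" "inj_on \<sigma> (dom \<sigma>) \<longrightarrow> inj_on \<chi> (dom \<chi>)"
      using factor_through[OF c(1,2) A(3)] c(3) by metis
    have "completion \<chi> \<in> carrier (hom_monoid injective)"
      using \<chi> c(4) by (intro completion_in_carrier) auto
    moreover have "\<phi> \<otimes>\<^bsub>hom_monoid injective\<^esub> completion \<chi> = \<sigma>"
      using \<chi> c(1) by (simp add: mult_hom_monoid fin_hom_hom hom_completion completion_comp_right)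
    ultimately show ?thesis by blast
  qed
  show ?thesis unfolding green_R_iff using assms * unfolding ess_equal_def by blast
qed

lemma inj_table:
  assumes "prefix_code Q" "prefix_code R" "bij_betw f Q R"
  shows "inj_on (table Q f) (dom (table Q f))"
proof (rule inj_onI)
  fix x x' assume x: "x \<in> dom (table Q f)" "x' \<in> dom (table Q f)" "table Q f x = table Q f x'"
  then obtain y where "table Q f x = Some y" "table R (inv_into Q f) y = Some x"
    using table_cancel[OF assms] dom_table by metis
  moreover obtain y' where "table Q f x' = Some y'" "table R (inv_into Q f) y' = Some x'"
    using x table_cancel[OF assms] dom_table by metis
  ultimately show "x = x'" using x(3) by simp
qed

lemma ran_table:
  assumes "prefix_code Q" "f ` Q = R"
  shows "ran (table Q f) = generated R"
proof
  show "ran (table Q f) \<subseteq> generated R"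
    unfolding ran_def using assms(2) by (auto elim!: table_SomeE[OF assms(1)] intro: generatedI)
  show "generated R \<subseteq> ran (table Q f)"
  proof
    fix y assume "y \<in> generated R"
    then obtain q w where q: "q \<in> Q" "y = f q @ w" using assms(2) by (elim generatedE) blast
    show "y \<in> ran (table Q f)" unfolding q(2) by (rule ranI) (rule table_append[OF assms(1) q(1)])
  qed
qed

text \<open>Following \<open>\<psi>\<close> by a bijection between the codes \<open>Q\<close> and \<open>R\<close> is invertible on the left, so it
  stays in the L-class of \<open>\<psi>\<close>; the image is moved to that of \<open>R\<close>.\<close>

lemma green_L_transport:
  fixes \<psi> :: "'a::finite list \<rightharpoonup> 'a list"
  assumes \<psi>: "\<psi> \<in> carrier (hom_monoid injective)"
    and Q: "finite Q" "prefix_code Q" "ess_equal (generated Q) (ran \<psi>)"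
    and R: "finite R" "prefix_code R" "card Q = card R"
  shows "\<exists>\<sigma>. (\<sigma>, \<psi>) \<in> green_L (hom_monoid injective) \<and> ess_equal (ran \<sigma>) (generated R)"
proof -
  interpret monoid "hom_monoid injective :: ('a list \<rightharpoonup> 'a list) monoid" by (rule monoid_hom_monoid)
  obtain f where f: "bij_betw f Q R" using Q R finite_same_card_bij by blast
  define \<beta> where "\<beta> = table Q f"
  define \<gamma> where "\<gamma> = table R (inv_into Q f)"
  have g: "bij_betw (inv_into Q f) R Q" using f by (rule bij_betw_inv_into)
  have fin: "fin_hom \<beta>" "fin_hom \<gamma>" "fin_hom \<psi>"
    using Q R \<psi> by (auto simp: \<beta>_def \<gamma>_def fin_hom_table carrier_hom_monoid)
  note h = fin[THEN fin_hom_hom]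
  have \<beta>: "completion \<beta> \<in> carrier (hom_monoid injective)"
    using completion_in_carrier fin inj_table[OF Q(2) R(2) f] unfolding \<beta>_def by blast
  have \<gamma>: "completion \<gamma> \<in> carrier (hom_monoid injective)"
    using completion_in_carrier fin inj_table[OF R(2) Q(2) g] unfolding \<gamma>_def by blast
  define \<sigma> where "\<sigma> = completion \<beta> \<otimes>\<^bsub>hom_monoid injective\<^esub> \<psi>"
  have \<sigma>: "\<sigma> = completion (\<beta> \<circ>\<^sub>m \<psi>)"
    by (simp add: \<sigma>_def mult_hom_monoid h hom_completion completion_comp_left)
  have "completion \<gamma> \<otimes>\<^bsub>hom_monoid injective\<^esub> \<sigma> = completion (\<gamma> \<circ>\<^sub>m (\<beta> \<circ>\<^sub>m \<psi>))"
    by (simp add: \<sigma> mult_hom_monoid h hom_completion hom_comp completion_comp_left completion_comp_right)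
  also have "\<dots> = completion \<psi>"
  proof (rule completion_cong_dense)
    have cancel: "\<exists>z. \<beta> y = Some z \<and> \<gamma> z = Some y" if "y \<in> dom \<beta>" for y
      using table_cancel[OF Q(2) R(2) f] that unfolding \<beta>_def \<gamma>_def dom_table by blast
    show "\<gamma> \<circ>\<^sub>m (\<beta> \<circ>\<^sub>m \<psi>) \<subseteq>\<^sub>m \<psi>"
      unfolding map_le_def
    proof
      fix x assume "x \<in> dom (\<gamma> \<circ>\<^sub>m (\<beta> \<circ>\<^sub>m \<psi>))"
      then obtain y z where "\<psi> x = Some y" "\<beta> y = Some z"
        by (auto simp: map_comp_Some_iff)
      then have "\<psi> x = Some y" "y \<in> dom \<beta>" by auto
      then show "(\<gamma> \<circ>\<^sub>m (\<beta> \<circ>\<^sub>m \<psi>)) x = \<psi> x" using cancel by fastforce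
    qed
    show "reaches (dom \<psi>) (dom (\<gamma> \<circ>\<^sub>m (\<beta> \<circ>\<^sub>m \<psi>)))"
      unfolding reaches_def
    proof
      fix x assume "x \<in> dom \<psi>"
      then obtain y where y: "\<psi> x = Some y" by blast
      then obtain w where "y @ w \<in> dom \<beta>"
        using Q(3) unfolding ess_equal_def reaches_def \<beta>_def dom_table by (meson ranI)
      moreover have "\<psi> (x @ w) = Some (y @ w)" by (rule homD[OF h(3) y])
      ultimately have "x @ w \<in> dom (\<gamma> \<circ>\<^sub>m (\<beta> \<circ>\<^sub>m \<psi>))" using cancel by fastforce
      then show "\<exists>w. x @ w \<in> dom (\<gamma> \<circ>\<^sub>m (\<beta> \<circ>\<^sub>m \<psi>))" by blast
    qed
  qed (intro hom_comp h)+
  also have "\<dots> = \<psi>" using \<psi> by (simp add: carrier_hom_monoid)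
  finally have "(\<sigma>, \<psi>) \<in> green_L (hom_monoid injective)"
    unfolding green_L_iff using \<psi> \<beta> \<gamma> m_closed[OF \<beta> \<psi>] \<sigma>_def by metis
  moreover have "ess_equal (ran (\<beta> \<circ>\<^sub>m \<psi>)) (generated R)"
  proof -
    have ranb: "ran \<beta> = generated R" unfolding \<beta>_def using ran_table Q(2) f by (metis bij_betw_def)
    have "ran (\<beta> \<circ>\<^sub>m \<psi>) \<subseteq> ran \<beta>" unfolding ran_def by (auto simp: map_comp_Some_iff)
    moreover have "\<exists>w. z @ w \<in> ran (\<beta> \<circ>\<^sub>m \<psi>)" if z: "z \<in> ran \<beta>" for z
    proof -
      obtain y where y: "\<beta> y = Some z" using z unfolding ran_def by blast
      then have "y \<in> generated Q" unfolding \<beta>_def using dom_table by blast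
      then obtain w where "y @ w \<in> ran \<psi>" using Q(3) unfolding ess_equal_def reaches_def by blast
      then obtain x where "\<psi> x = Some (y @ w)" unfolding ran_def by blast
      then have "(\<beta> \<circ>\<^sub>m \<psi>) x = Some (z @ w)" using homD[OF h(1) y] by simp
      then show ?thesis by (meson ranI)
    qed
    ultimately show ?thesis unfolding ess_equal_def ranb by (auto simp: reaches_subset) (auto simp: reaches_def)
  qed
  then have "ess_equal (ran \<sigma>) (generated R)"
    unfolding \<sigma> using ran_completion[OF hom_comp[OF h(1,3)]] ess_equal_trans by blast
  ultimately show ?thesis by blast
qed

lemma card_cong_green_D:
  fixes \<phi> \<psi> :: "'a::finite list \<rightharpoonup> 'a list"
  assumes \<phi>: "\<phi> \<in> carrier (hom_monoid injective)" "\<phi> \<noteq> Map.empty"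
    and \<psi>: "\<psi> \<in> carrier (hom_monoid injective)" "\<psi> \<noteq> Map.empty"
    and cong: "[card (imC \<phi>) = card (imC \<psi>)] (mod (CARD('a) - 1))" and card: "CARD('a) \<ge> 1"
  shows "(\<phi>, \<psi>) \<in> green_D (hom_monoid injective)"
proof -
  have fin: "fin_hom \<phi>" "fin_hom \<psi>" using \<phi> \<psi> by (auto simp: carrier_hom_monoid)
  obtain i j where ij: "card (imC \<psi>) + i * (CARD('a) - 1) = card (imC \<phi>) + j * (CARD('a) - 1)"
    using cong unfolding cong_iff_lin_nat by blast
  obtain R where R: "finite R" "prefix_code R" "ess_equal (generated R) (generated (imC \<phi>))"
      "card R = card (imC \<phi>) + j * (CARD('a) - 1)"
    using expand_code[OF imC_props(1,2)[OF fin(1)] imC_nonempty[OF fin(1) \<phi>(2)] card] by blast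
  obtain Q where Q: "finite Q" "prefix_code Q" "ess_equal (generated Q) (generated (imC \<psi>))"
      "card Q = card (imC \<psi>) + i * (CARD('a) - 1)"
    using expand_code[OF imC_props(1,2)[OF fin(2)] imC_nonempty[OF fin(2) \<psi>(2)] card] by blast
  have "card Q = card R" using ij R(4) Q(4) by simp
  then obtain \<sigma> where \<sigma>: "(\<sigma>, \<psi>) \<in> green_L (hom_monoid injective)" "ess_equal (ran \<sigma>) (generated R)"
    using green_L_transport[OF \<psi>(1) Q(1,2) ess_equal_trans[OF Q(3) imC_props(3)[OF fin(2)]] R(1,2)]
    by blast
  have "ess_equal (ran \<phi>) (ran \<sigma>)"
    using \<sigma>(2) R(3) imC_props(3)[OF fin(1)] ess_equal_sym ess_equal_trans by blast
  moreover have "\<sigma> \<in> carrier (hom_monoid injective)" using \<sigma>(1) unfolding green_L_def by blast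
  ultimately show ?thesis
    using ess_equal_ran_green_R[OF \<phi>(1)] \<sigma>(1) unfolding green_D_def by blast
qed

section \<open>Counting the non-zero D-classes\<close>

lemma zero_in_carrier: "Map.empty \<in> carrier (hom_monoid injective)"
proof -
  have h: "right_ideal_hom Map.empty" by (rule homI) simp
  then have "completion Map.empty = Map.empty"
    by (metis completionD option.distinct(1) option.exhaust ext)
  then show ?thesis using h by (simp add: carrier_hom_monoid fin_hom_def)
qed

lemma green_D_zero_iff:
  fixes \<phi> \<psi> :: "'a list \<rightharpoonup> 'a list"
  assumes "(\<phi>, \<psi>) \<in> green_D (hom_monoid injective)"
  shows "\<phi> = Map.empty \<longleftrightarrow> \<psi> = Map.empty"
proof -
  obtain \<sigma> where \<sigma>: "(\<phi>, \<sigma>) \<in> green_R (hom_monoid injective)" "(\<sigma>, \<psi>) \<in> green_L (hom_monoid injective)"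
    using assms unfolding green_D_def by blast
  interpret monoid "hom_monoid injective :: ('a list \<rightharpoonup> 'a list) monoid" by (rule monoid_hom_monoid)
  have 0: "completion (Map.empty :: 'a list \<rightharpoonup> 'a list) = Map.empty"
    using zero_in_carrier[where injective = False, unfolded carrier_hom_monoid] by blast
  have ann: "Map.empty \<otimes>\<^bsub>hom_monoid injective\<^esub> \<chi> = Map.empty"
    "\<chi> \<otimes>\<^bsub>hom_monoid injective\<^esub> Map.empty = Map.empty"
    if "\<chi> \<in> carrier (hom_monoid injective)" for \<chi> :: "'a list \<rightharpoonup> 'a list"
  proof -
    have "right_ideal_hom \<chi>" "right_ideal_hom (Map.empty :: 'a list \<rightharpoonup> 'a list)"
      using that zero_in_carrier[where injective = True, unfolded carrier_hom_monoid]
        fin_hom_hom unfolding carrier_hom_monoid by blast+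
    moreover have "(Map.empty :: 'a list \<rightharpoonup> 'a list) \<circ>\<^sub>m \<chi> = Map.empty"
      "\<chi> \<circ>\<^sub>m (Map.empty :: 'a list \<rightharpoonup> 'a list) = Map.empty"
      by (auto simp: map_comp_def split: option.splits)
    ultimately show "Map.empty \<otimes>\<^bsub>hom_monoid injective\<^esub> \<chi> = Map.empty"
      "\<chi> \<otimes>\<^bsub>hom_monoid injective\<^esub> Map.empty = Map.empty"
      by (simp_all add: mult_hom_monoid 0)
  qed
  show ?thesis using \<sigma> ann unfolding green_R_iff green_L_iff by metis
qed

text \<open>A partial identity on the words that start with one of r letters has an image code of
  size congruent to r, since these letters themselves form a prefix code for its image.\<close>

lemma exists_imC_card:
  assumes "1 \<le> r" "r \<le> CARD('a::finite)"
  shows "\<exists>\<phi> :: 'a list \<rightharpoonup> 'a list. \<phi> \<in> carrier (hom_monoid injective) \<and> \<phi> \<noteq> Map.empty \<and>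
    [card (imC \<phi>) = r] (mod (CARD('a) - 1))"
proof -
  obtain S :: "'a set" where S: "card S = r" using assms(2) by (meson obtain_subset_with_card_n)
  define P where "P = (\<lambda>a. [a]) ` S"
  have P: "finite P" "prefix_code P" "card P = r" "P \<noteq> {}"
    using S assms(1) by (auto simp: P_def prefix_code_def card_image inj_on_def)
  define \<iota> where "\<iota> = table P id"
  have fin: "fin_hom \<iota>" unfolding \<iota>_def using fin_hom_table P by blast
  note h = fin_hom_hom[OF fin]
  have "inj_on \<iota> (dom \<iota>)"
    unfolding \<iota>_def using inj_table[OF P(2) P(2), of id] by simp
  then have c: "completion \<iota> \<in> carrier (hom_monoid injective)"
    using completion_in_carrier[OF fin] by blast
  have "dom \<iota> \<noteq> {}" unfolding \<iota>_def dom_table using P(4) generatedI by fastforce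
  then have "completion \<iota> \<noteq> Map.empty"
    using map_le_implies_dom_le[OF completion_extends[OF h]] by auto
  moreover have "ess_equal (generated (imC (completion \<iota>))) (generated P)"
    using imC_props(3)[OF fin_hom_completion[OF fin]] ran_completion[OF h]
      ran_table[OF P(2), of id P] ess_equal_trans unfolding \<iota>_def by fastforce
  then have "[card (imC (completion \<iota>)) = card P] (mod (CARD('a) - 1))"
    using ess_equal_card_cong[OF imC_props(1,2)[OF fin_hom_completion[OF fin]] P(1,2)] assms by simp
  ultimately show ?thesis using c P(3) by blast
qed

lemma green_D_iff:
  fixes \<phi> \<psi> :: "'a::finite list \<rightharpoonup> 'a list"
  assumes "\<phi> \<in> carrier (hom_monoid injective) - {Map.empty}"
    "\<psi> \<in> carrier (hom_monoid injective) - {Map.empty}" "CARD('a) \<ge> 1"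
  shows "(\<phi>, \<psi>) \<in> green_D (hom_monoid injective)
     \<longleftrightarrow> [card (imC \<phi>) = card (imC \<psi>)] (mod (CARD('a) - 1))"
  using assms green_D_card_cong card_cong_green_D by blast

lemma green_D_class:
  fixes \<phi> :: "'a::finite list \<rightharpoonup> 'a list"
  assumes "\<phi> \<in> carrier (hom_monoid injective) - {Map.empty}" "CARD('a) \<ge> 1"
  shows "green_D (hom_monoid injective) `` {\<phi>} = {\<psi> \<in> carrier (hom_monoid injective) - {Map.empty}.
     [card (imC \<phi>) = card (imC \<psi>)] (mod (CARD('a) - 1))}"
proof -
  have "\<psi> \<in> carrier (hom_monoid injective) - {Map.empty}"
    if "(\<phi>, \<psi>) \<in> green_D (hom_monoid injective)" for \<psi>
    using green_D_zero_iff[OF that] that assms(1) unfolding green_D_def green_L_def by blast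
  then show ?thesis using green_D_iff[OF assms(1) _ assms(2)] by blast
qed

lemma nonzero_green_D_classes:
  assumes "CARD('a::finite) \<ge> 1"
  shows "{K \<in> carrier (hom_monoid injective) // green_D (hom_monoid injective). Map.empty \<notin> K} =
    (\<lambda>\<phi> :: 'a list \<rightharpoonup> 'a list. green_D (hom_monoid injective) `` {\<phi>})
      ` (carrier (hom_monoid injective) - {Map.empty})"
proof -
  interpret monoid "hom_monoid injective :: ('a list \<rightharpoonup> 'a list) monoid" by (rule monoid_hom_monoid)
  have "(Map.empty, Map.empty) \<in> green_R (hom_monoid injective)"
    "(Map.empty, Map.empty) \<in> green_L (hom_monoid injective)"
    using zero_in_carrier unfolding green_R_def green_L_def by auto
  then have "(Map.empty, Map.empty) \<in> green_D (hom_monoid injective)"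
    unfolding green_D_def by blast
  moreover have "Map.empty \<notin> green_D (hom_monoid injective) `` {\<phi>}" if "\<phi> \<noteq> Map.empty"
    for \<phi> :: "'a list \<rightharpoonup> 'a list"
    using that green_D_zero_iff by blast
  ultimately show ?thesis unfolding quotient_def by blast
qed

lemma card_nonzero_green_D_classes:
  assumes "CARD('a::finite) \<ge> 2"
  shows "card {K \<in> carrier (hom_monoid injective :: ('a list \<rightharpoonup> 'a list) monoid) // green_D (hom_monoid injective).
     Map.empty \<notin> K} = CARD('a) - 1"
proof -
  let ?C = "carrier (hom_monoid injective :: ('a list \<rightharpoonup> 'a list) monoid) - {Map.empty}"
  let ?k = "CARD('a) - 1"
  define cls where "cls r = {\<psi> \<in> ?C. card (imC \<psi>) mod ?k = r}" for r
  have ex: "\<exists>\<phi>\<in>?C. card (imC \<phi>) mod ?k = r" if "r < ?k" for r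
  proof (cases "r = 0")
    case True
    \<comment> \<open>image codes of non-zero elements are non-empty, so residue 0 is represented by size k - 1\<close>
    have "1 \<le> ?k" "?k \<le> CARD('a)" using assms by simp_all
    from exists_imC_card[OF this] obtain \<phi> :: "'a list \<rightharpoonup> 'a list"
      where "\<phi> \<in> ?C" "[card (imC \<phi>) = ?k] (mod ?k)" by blast
    then show ?thesis using True by (intro bexI[of _ \<phi>]) (simp_all add: cong_def)
  next
    case False
    then have "1 \<le> r" "r \<le> CARD('a)" using that by simp_all
    from exists_imC_card[OF this] obtain \<phi> :: "'a list \<rightharpoonup> 'a list"
      where "\<phi> \<in> ?C" "[card (imC \<phi>) = r] (mod ?k)" by blast
    then show ?thesis using that by (intro bexI[of _ \<phi>]) (simp_all add: cong_def)
  qed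
  have img: "(\<lambda>\<phi>. green_D (hom_monoid injective) `` {\<phi>}) ` ?C = cls ` {..<?k}"
  proof
    show "(\<lambda>\<phi>. green_D (hom_monoid injective) `` {\<phi>}) ` ?C \<subseteq> cls ` {..<?k}"
    proof
      fix K assume "K \<in> (\<lambda>\<phi>. green_D (hom_monoid injective) `` {\<phi>}) ` ?C"
      then obtain \<phi> where "\<phi> \<in> ?C" "K = green_D (hom_monoid injective) `` {\<phi>}" by blast
      then have "K = cls (card (imC \<phi>) mod ?k)"
        using green_D_class[of \<phi>] assms by (auto simp: cls_def cong_def)
      then show "K \<in> cls ` {..<?k}" using assms by simp
    qed
  next
    show "cls ` {..<?k} \<subseteq> (\<lambda>\<phi>. green_D (hom_monoid injective) `` {\<phi>}) ` ?C"
    proof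
      fix K assume "K \<in> cls ` {..<?k}"
      then obtain r where r: "r < ?k" "K = cls r" by blast
      obtain \<phi> where \<phi>: "\<phi> \<in> ?C" "card (imC \<phi>) mod ?k = r"
        using ex[OF r(1)] by blast
      then have "K = green_D (hom_monoid injective) `` {\<phi>}"
        using green_D_class[of \<phi>] assms r by (auto simp: cls_def cong_def)
      then show "K \<in> (\<lambda>\<phi>. green_D (hom_monoid injective) `` {\<phi>}) ` ?C" using \<phi> by blast
    qed
  qed
  have "inj_on cls {..<?k}"
  proof (rule inj_onI)
    fix r s assume r: "r \<in> {..<?k}" "cls r = cls s"
    obtain \<phi> where "\<phi> \<in> cls r" using ex[of r] r(1) unfolding cls_def by auto
    then show "r = s" using r(2) unfolding cls_def by auto
  qed
  then have "card (cls ` {..<?k}) = ?k" by (simp add: card_image)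
  then show ?thesis using nonzero_green_D_classes[where injective = injective and 'a = 'a] img assms by simp
qed

theorem theorem2p5:
  fixes M :: "('a::finite list \<rightharpoonup> 'a list) monoid" and k :: nat
  assumes "CARD('a) = k" and "k \<ge> 2"
    and "M = M_k1 \<or> M = Inv_k1"
  shows "(\<forall>\<phi> \<in> carrier M - {Map.empty}. \<forall>\<psi> \<in> carrier M - {Map.empty}.
            (\<phi>, \<psi>) \<in> green_D M \<longleftrightarrow> [card (imC \<phi>) = card (imC \<psi>)] (mod (k - 1)))
       \<and> card {K \<in> carrier M // green_D M. Map.empty \<notin> K} = k - 1
       \<and> (k = 2 \<longrightarrow> zero_D_simple M Map.empty)"
proof -
  obtain injective where M: "M = hom_monoid injective"
    using assms(3) M_k1_eq Inv_k1_eq by blast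
  have card: "CARD('a) \<ge> 1" "CARD('a) \<ge> 2" using assms by auto
  have "zero_D_simple M Map.empty" if "k = 2"
  proof -
    have S: "Some \<in> carrier M - {Map.empty}"
      unfolding M using Some_in_carrier by (auto dest: fun_cong)
    then have "green_D M `` {Some} = carrier M - {Map.empty}"
      using green_D_class[OF _ card(1)] that assms(1) unfolding M by (auto simp: cong_def)
    then show ?thesis unfolding zero_D_simple_def using S by (metis DiffD1 quotientI)
  qed
  then show ?thesis
    using green_D_iff[OF _ _ card(1)] card_nonzero_green_D_classes[OF card(2)] assms(1)
    unfolding M by blast
qed

end
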